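(* Let $k\ge 2$ be a fixed integer, let $p=p(N)\in(0,1]$ for each integer $N>k$, and let $\mathcal A\in\mathcal S(N,k,p)$ be a random system. Then: (1) if $p=o(N^{-(2k+1)/4})$ as $N\to\infty$, then $\lim_{N\to\infty}\Pr(\mathcal A\text{ is a Sidon system})=1$; (2) if $p=\omega(N^{-(2k+1)/4})$ as $N\to\infty$, then $\lim_{N\to\infty}\Pr(\mathcal A\text{ is a Sidon system})=0$.
   Context: For a positive integer $N$ let $[N]=\{1,2,\dots,N\}$, and let $\binom{[N]}{k}$ denote the family of all $k$-element subsets of $[N]$. For sets of integers $A,B$, the sumset is $A+B=\{a+b: a\in A, b\in B\}$. A family $\mathcal A=\{A_i: i\in I\}$ of (distinct) subsets of $\mathbb Z$ is a Sidon system if $A_i+A_j=A_{i'}+A_{j'}$ implies $\{i,j\}=\{i',j'\}$ for all $i,j,i',j'\in I$. For $N>k$ and $0<p\le 1$, $\mathcal A\in\mathcal S(N,k,p)$ means that $\mathcal A$ is the random subfamily of $\binom{[N]}{k}$ obtained by including each set $A\in\binom{[N]}{k}$ independently with probability $p$. The notation $p=o(f(N))$ means $p(N)/f(N)\to0$, and $p=\omega(f(N))$ means $p(N)/f(N)\to\infty$, as $N\to\infty$. *)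

theory Defs
  imports
    "HOL-Probability.Probability"
    "HOL-Library.Landau_Symbols"
    "HOL-Library.Set_Algebras"
    "HOL-Library.Ramsey"
begin

text \<open>
  A family of distinct sets is represented by the set of its members, which serves as its own
  index set. The addition on sets is the sumset operation of \<^theory>\<open>HOL-Library.Set_Algebras\<close>.
\<close>
definition sidon_system :: "int set set \<Rightarrow> bool" where
  "sidon_system \<A> \<longleftrightarrow>
     (\<forall>A\<in>\<A>. \<forall>B\<in>\<A>. \<forall>C\<in>\<A>. \<forall>D\<in>\<A>. A + B = C + D \<longrightarrow> {A, B} = {C, D})"

definition k_subsets :: "nat \<Rightarrow> nat \<Rightarrow> int set set" where
  "k_subsets N k = nsets {1..int N} k"

text \<open>
  The distribution of a random system: one independent Bernoulli trial of parameter \<open>p\<close> for each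
  \<open>k\<close>-element subset of \<open>{1..N}\<close>, collecting the subsets whose trial succeeds.
  For \<open>p\<close> outside \<open>[0, 1]\<close> the constant \<^const>\<open>bernoulli_pmf\<close> has no intended meaning.
\<close>
definition random_system :: "nat \<Rightarrow> nat \<Rightarrow> real \<Rightarrow> int set set pmf" where
  "random_system N k p =
     map_pmf (\<lambda>f. {A \<in> k_subsets N k. f A})
       (Pi_pmf (k_subsets N k) False (\<lambda>_. bernoulli_pmf p))"

end

theory Submission
  imports Defs
begin

text \<open>
  Write \<open>\<gamma> = (2k+1)/4\<close>. Below the threshold, a union bound over the bad quadruples \<open>A + B = C + D\<close>
  suffices, provided those with \<open>s\<close> distinct members number \<open>O(N\<^bsup>s\<gamma>\<^esup>)\<close>. Given \<open>A\<close>, \<open>B\<close> and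
  \<open>min C\<close>, the sets \<open>C\<close> and \<open>D\<close> lie in translates of \<open>A + B\<close>, which leaves boundedly many choices; this
  settles every case except \<open>A + B = A + D\<close>, where a bound \<open>O(N\<^bsup>3k/2\<^esup>)\<close> is needed. There, pick
  \<open>b \<in> B - D\<close>. Each \<open>a \<in> A\<close> has some \<open>a' \<in> A - {a}\<close> with \<open>a + b - a' \<in> D\<close>. Following \<open>a \<mapsto> a'\<close>
  around a cycle determines \<open>b\<close> from \<open>D\<close> up to boundedly many choices, and the graph on \<open>A\<close>
  with edges \<open>{a, a'}\<close> has no isolated vertices, hence a dominating set of at most \<open>k/2\<close> elements, which
  together with \<open>D\<close> and \<open>b\<close> determines \<open>A\<close> up to boundedly many choices.

  Above the threshold, the second moment method applies to the quadruples \<open>A, A + t, B, B + t\<close>, which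
  violate the Sidon property since \<open>A + (B + t) = (A + t) + B\<close>. There are of order \<open>N\<^bsup>4\<gamma>\<^esup>\<close> of
  them, and any \<open>r\<close> given sets lie in only \<open>O(N\<^bsup>(4-r)\<gamma>\<^esup>)\<close> of them.
\<close>

subsection \<open>Sumsets of \<open>k\<close>-sets\<close>

lemma card_UN_le_mult:
  assumes "finite I" "\<And>i. i \<in> I \<Longrightarrow> card (F i) \<le> c"
  shows "card (\<Union>i\<in>I. F i) \<le> card I * c"
proof -
  have "card (\<Union>i\<in>I. F i) \<le> (\<Sum>i\<in>I. card (F i))"
    by (rule card_UN_le[OF assms(1)])
  also have "\<dots> \<le> card I * c"
    using sum_bounded_above[of I "\<lambda>i. card (F i)" c] assms(2) by simp
  finally show ?thesis .
qed

text \<open>The complement of a minimal dominating set is again dominating.\<close>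

lemma dominating_set_half:
  fixes V :: "'a set"
  assumes "finite V"
    and sym: "\<And>u v. E u v \<Longrightarrow> E v u"
    and no_isolated: "\<And>v. v \<in> V \<Longrightarrow> \<exists>w\<in>V. w \<noteq> v \<and> E v w"
  obtains R where "R \<subseteq> V" "2 * card R \<le> card V" "\<And>v. v \<in> V - R \<Longrightarrow> \<exists>r\<in>R. E v r"
proof -
  define dom where "dom = (\<lambda>R. R \<subseteq> V \<and> (\<forall>v\<in>V - R. \<exists>r\<in>R. E v r))"
  have "dom V" by (auto simp: dom_def)
  then obtain R where R: "dom R" and min: "\<And>S. dom S \<Longrightarrow> card R \<le> card S"
    using exists_least_iff[of "\<lambda>n. \<exists>S. dom S \<and> card S = n"]
    by (metis not_le_imp_less)
  have "finite R" "R \<subseteq> V"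
    using R assms(1) finite_subset by (auto simp: dom_def)
  have "dom (V - R)"
    unfolding dom_def
  proof (intro conjI ballI)
    fix r assume "r \<in> V - (V - R)"
    then have r: "r \<in> R" "r \<in> V" by auto
    show "\<exists>w\<in>V - R. E r w"
    proof (rule ccontr)
      assume none: "\<not> (\<exists>w\<in>V - R. E r w)"
      \<comment> \<open>With no neighbour outside \<open>R\<close>, the vertex \<open>r\<close>
        dominates nothing there, and its own neighbour lies in \<open>R - {r}\<close>. So
        \<open>r\<close> could be dropped, against minimality.\<close>
      have "dom (R - {r})"
        unfolding dom_def
      proof (intro conjI ballI)
        fix v assume v: "v \<in> V - (R - {r})"
        show "\<exists>s\<in>R - {r}. E v s"
        proof (cases "v = r")
          case True
          then show ?thesis using no_isolated[OF r(2)] none by blast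
        next
          case False
          then obtain s where "s \<in> R" "E v s" using v R by (auto simp: dom_def)
          then show ?thesis using none sym v False by blast
        qed
      qed (use \<open>R \<subseteq> V\<close> in auto)
      then have "card R \<le> card (R - {r})" by (rule min)
      then show False using r(1) \<open>finite R\<close> by (meson card_Diff1_less not_le)
    qed
  qed auto
  then have le: "card R \<le> card (V - R)" by (rule min)
  have "card (V - R) = card V - card R"
    using \<open>finite R\<close> \<open>R \<subseteq> V\<close> by (simp add: card_Diff_subset)
  moreover have "card R \<le> card V"
    using \<open>R \<subseteq> V\<close> assms(1) by (simp add: card_mono)
  ultimately have "2 * card R \<le> card V" using le by linarith
  then show thesis using that R by (auto simp: dom_def)
qed

section \<open>Sizes and minima of sumsets of \<open>k\<close>-subsets\<close>

lemma k_subsetsD: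
  assumes "A \<in> k_subsets N k"
  shows "finite A" "card A = k" "A \<subseteq> {1..int N}"
  using assms by (auto simp: k_subsets_def nsets_def)

lemma finite_k_subsets [simp]: "finite (k_subsets N k)"
  by (simp add: k_subsets_def finite_imp_finite_nsets)

lemma card_nsets_interval:
  fixes a b :: int
  shows "card (nsets {a..b} k) = nat (b - a + 1) choose k"
proof -
  have "nsets {a..b} k = {A. A \<subseteq> {a..b} \<and> card A = k}"
    by (auto simp: nsets_def intro: finite_subset[OF _ finite_atLeastAtMost_int])
  then show ?thesis by (simp add: n_subsets)
qed

lemma card_k_subsets: "card (k_subsets N k) = N choose k"
  by (simp add: k_subsets_def card_nsets_interval)

lemma card_k_subsets_le: "card (k_subsets N k) \<le> N ^ k"
  by (cases "k \<le> N") (auto simp: card_k_subsets binomial_le_pow binomial_eq_0)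

lemma card_sumset_le:
  fixes A B :: "int set"
  assumes "finite A" "finite B"
  shows "card (A + B) \<le> card A * card B"
  unfolding set_plus_image
  using card_image_le[of "A \<times> B" "\<lambda>(x, y). x + y"] assms by (simp add: card_cartesian_product)

lemma Min_sumset:
  fixes A B :: "int set"
  assumes "finite A" "A \<noteq> {}" "finite B" "B \<noteq> {}"
  shows "Min (A + B) = Min A + Min B"
proof (rule Min_eqI)
  show "finite (A + B)" using assms by (simp add: finite_set_plus)
  show "Min A + Min B \<in> A + B" using assms by (intro set_plus_intro) auto
  fix y assume "y \<in> A + B"
  then show "Min A + Min B \<le> y"
    using assms by (auto elim!: set_plus_elim intro!: add_mono)
qed

text \<open>Once the sumset and the minimum of one summand are known, the other summand is confined
  to a set of bounded size, hence has boundedly many candidates.\<close>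

lemma subset_shift_sumset:
  fixes C D :: "int set"
  assumes "finite D" "D \<noteq> {}"
  shows "C \<subseteq> (\<lambda>x. x - Min D) ` (C + D)"
proof
  fix c assume "c \<in> C"
  then have "c + Min D \<in> C + D" using assms by (intro set_plus_intro) auto
  then show "c \<in> (\<lambda>x. x - Min D) ` (C + D)" by force
qed

lemma card_shift_sumset_le:
  fixes A B :: "int set"
  assumes "A \<in> k_subsets N k" "B \<in> k_subsets N k"
  shows "card ((\<lambda>x. x - d) ` (A + B)) \<le> k * k"
    and "finite ((\<lambda>x. x - d) ` (A + B))"
proof -
  note A = k_subsetsD[OF assms(1)] and B = k_subsetsD[OF assms(2)]
  show "finite ((\<lambda>x. x - d) ` (A + B))" using A B by (simp add: finite_set_plus)
  have "card ((\<lambda>x. x - d) ` (A + B)) \<le> card (A + B)"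
    using A B by (simp add: card_image_le finite_set_plus)
  then show "card ((\<lambda>x. x - d) ` (A + B)) \<le> k * k"
    using card_sumset_le[of A B] A B by simp
qed

lemma card_Pow_shift_sumset_le:
  fixes A B :: "int set"
  assumes "A \<in> k_subsets N k" "B \<in> k_subsets N k"
  shows "card (Pow ((\<lambda>x. x - d) ` (A + B))) \<le> 2 ^ (k * k)"
  using card_shift_sumset_le[OF assms] by (simp add: card_Pow power_increasing)

text \<open>Minima add up, so \<open>A\<close>, \<open>B\<close> and \<open>Min C\<close> determine
  \<open>Min D\<close>. Then \<open>C\<close> and \<open>D\<close> are subsets of known translates
  of \<open>A + B\<close>, and \<open>Min C\<close> alone costs the factor \<open>N\<close>. Leaving
  \<open>S\<close> general serves both the full square and the diagonal
  \<open>A = B\<close>.\<close>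

lemma card_equal_sumsets_le:
  assumes S: "S \<subseteq> k_subsets N k \<times> k_subsets N k" and "k \<ge> 1"
  shows "card {(A, B, C, D). (A, B) \<in> S \<and> C \<in> k_subsets N k \<and> D \<in> k_subsets N k \<and> A + B = C + D}
    \<le> card S * (N * (2 ^ (k * k) * 2 ^ (k * k)))" (is "card ?Q \<le> _")
proof -
  have finS: "finite S" using S finite_subset by fastforce
  \<comment> \<open>Here \<open>m\<close> stands for \<open>Min C\<close>; the two power sets hold
    the candidates for \<open>C\<close> and for \<open>D\<close>.\<close>
  define F where "F = (\<lambda>(A, B) m. (\<lambda>(C, D). (A, B, C, D)) `
      (Pow ((\<lambda>x. x - (Min A + Min B - m)) ` (A + B)) \<times> Pow ((\<lambda>x. x - m) ` (A + B :: int set))))"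
  have "?Q \<subseteq> (\<Union>(A, B)\<in>S. \<Union>m\<in>{1..int N}. F (A, B) m)"
  proof
    fix q assume "q \<in> ?Q"
    then obtain A B C D where q: "q = (A, B, C, D)" and AB: "(A, B) \<in> S"
      and C: "C \<in> k_subsets N k" and D: "D \<in> k_subsets N k" and eq: "A + B = C + D" by auto
    have A: "A \<in> k_subsets N k" and B: "B \<in> k_subsets N k" using AB S by auto
    have ne: "A \<noteq> {}" "B \<noteq> {}" "C \<noteq> {}" "D \<noteq> {}"
      using k_subsetsD(2)[OF A] k_subsetsD(2)[OF B] k_subsetsD(2)[OF C] k_subsetsD(2)[OF D] \<open>k \<ge> 1\<close>
      by auto
    note fin = k_subsetsD(1)[OF A] k_subsetsD(1)[OF B] k_subsetsD(1)[OF C] k_subsetsD(1)[OF D]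
    have "Min D = Min A + Min B - Min C"
      using arg_cong[OF eq, of Min] ne fin by (simp add: Min_sumset)
    then have "C \<subseteq> (\<lambda>x. x - (Min A + Min B - Min C)) ` (A + B)"
      using subset_shift_sumset[of D C] fin ne eq by simp
    moreover have "D \<subseteq> (\<lambda>x. x - Min C) ` (A + B)"
      using subset_shift_sumset[of C D] fin ne eq by (simp add: add.commute)
    moreover have "Min C \<in> {1..int N}"
      using Min_in[OF fin(3) ne(3)] k_subsetsD(3)[OF C] by blast
    ultimately have "q \<in> F (A, B) (Min C)" "Min C \<in> {1..int N}"
      unfolding q F_def by auto
    then show "q \<in> (\<Union>(A, B)\<in>S. \<Union>m\<in>{1..int N}. F (A, B) m)"
      using AB by (intro UN_I[of "(A, B)"] UN_I[of "Min C"]) auto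
  qed
  moreover have "finite (\<Union>(A, B)\<in>S. \<Union>m\<in>{1..int N}. F (A, B) m)"
    using S finS by (auto simp: F_def intro!: finite_imageI finite_cartesian_product card_shift_sumset_le
        dest!: subsetD intro: k_subsetsD finite_set_plus)
  ultimately have "card ?Q \<le> card (\<Union>(A, B)\<in>S. \<Union>m\<in>{1..int N}. F (A, B) m)"
    by (rule card_mono[rotated])
  also have "\<dots> \<le> card S * (N * (2 ^ (k * k) * 2 ^ (k * k)))"
  proof (rule card_UN_le_mult[OF finS], clarify)
    fix A B assume "(A, B) \<in> S"
    then have A: "A \<in> k_subsets N k" and B: "B \<in> k_subsets N k" using S by auto
    have "card (F (A, B) m) \<le> 2 ^ (k * k) * 2 ^ (k * k)" for m
    proof -
      have "card (F (A, B) m) \<le> card (Pow ((\<lambda>x. x - (Min A + Min B - m)) ` (A + B)) \<times>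
          Pow ((\<lambda>x. x - m) ` (A + B)))"
        unfolding F_def prod.case using card_shift_sumset_le(2)[OF A B]
        by (intro card_image_le finite_cartesian_product) auto
      also have "\<dots> \<le> 2 ^ (k * k) * 2 ^ (k * k)"
        unfolding card_cartesian_product
        by (intro mult_mono card_Pow_shift_sumset_le[OF A B]) auto
      finally show ?thesis .
    qed
    then show "card (\<Union>m\<in>{1..int N}. F (A, B) m) \<le> N * (2 ^ (k * k) * 2 ^ (k * k))"
      using card_UN_le_mult[of "{1..int N}" "F (A, B)"] by simp
  qed
  finally show ?thesis .
qed

text \<open>Following \<open>a + b = \<phi> a + d\<close> around a cycle of \<open>\<phi>\<close> expresses a multiple of \<open>b\<close> by elements of \<open>D\<close>.\<close>

lemma shift_determined:
  fixes A D :: "int set"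
  assumes "finite A" "A \<noteq> {}" and step: "\<And>a. a \<in> A \<Longrightarrow> a + b \<in> A + D"
  shows "b \<in> (\<lambda>ds. sum_list ds div int (length ds)) ` {ds. set ds \<subseteq> D \<and> length ds \<le> card A}"
proof -
  have "\<forall>a\<in>A. \<exists>a'\<in>A. a + b - a' \<in> D"
  proof
    fix a assume "a \<in> A"
    then obtain a' d where "a + b = a' + d" "a' \<in> A" "d \<in> D"
      using step by (blast elim: set_plus_elim)
    then show "\<exists>a'\<in>A. a + b - a' \<in> D" by (intro bexI[of _ a']) auto
  qed
  then obtain \<phi> where \<phi>: "\<And>a. a \<in> A \<Longrightarrow> \<phi> a \<in> A" "\<And>a. a \<in> A \<Longrightarrow> a + b - \<phi> a \<in> D"
    by metis
  obtain a where "a \<in> A" using assms(2) by auto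
  define f where "f i = (\<phi> ^^ i) a" for i
  have fA: "f i \<in> A" for i
    by (induction i) (auto simp: f_def \<phi> \<open>a \<in> A\<close>)
  \<comment> \<open>Pigeonhole: there are \<open>card A + 1\<close> indices, and the orbit stays in
    \<open>A\<close>.\<close>
  have "\<not> inj_on f {..card A}"
  proof
    assume "inj_on f {..card A}"
    then have "card {..card A} \<le> card A"
      using fA assms(1) by (intro card_inj_on_le) auto
    then show False by simp
  qed
  then obtain i j where ij: "i < j" "j \<le> card A" "f i = f j"
    unfolding inj_on_def by (metis atMost_iff linorder_neqE_nat)
  \<comment> \<open>The elements of \<open>D\<close> met along the cycle. Their sum telescopes to
    \<open>(j - i) * b\<close>, and \<open>i < j\<close> makes the division by
    \<open>length ds\<close> exact.\<close>
  define ds where "ds = map (\<lambda>l. f l + b - f (Suc l)) [i..<j]"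
  have "set ds \<subseteq> D"
    using fA \<phi>(2) by (auto simp: ds_def f_def)
  moreover have "sum_list ds = int (j - i) * b"
  proof -
    have "sum_list ds = (\<Sum>l=i..<j. b - (f (Suc l) - f l))"
      by (simp add: ds_def sum_list_distinct_conv_sum_set algebra_simps)
    also have "\<dots> = int (j - i) * b - (f j - f i)"
      using ij sum_Suc_diff'[of i j f] by (simp only: sum_subtractf) simp
    finally show ?thesis using ij by simp
  qed
  moreover have "length ds = j - i" by (simp add: ds_def)
  ultimately show ?thesis
    using ij by (intro image_eqI[of _ _ ds]) auto
qed

text \<open>The sets are chosen in the order \<open>D\<close>, \<open>b\<close>, dominating set,
  \<open>A\<close>, \<open>B\<close>. Only \<open>D\<close> and the dominating set cost powers of
  \<open>N\<close>, namely \<open>k\<close> and \<open>k div 2\<close>; the other choices are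
  bounded in terms of \<open>k\<close>.\<close>

lemma card_common_summand_le:
  assumes "k \<ge> 1" "N \<ge> 1"
  shows "card {(A, B, D). A \<in> k_subsets N k \<and> B \<in> k_subsets N k \<and> D \<in> k_subsets N k \<and>
      A + B = A + D \<and> B \<noteq> D}
    \<le> N ^ k * ((\<Sum>i\<le>k. k ^ i) * (((k + 1) * N ^ (k div 2)) * (2 ^ (k * (2 * k + 1)) * 2 ^ (k * k))))"
    (is "card ?T \<le> _")
proof -
  define K where "K = k_subsets N k"
  define shifts where
    "shifts D = (\<lambda>ds. sum_list ds div int (length ds)) ` {ds. set ds \<subseteq> D \<and> length ds \<le> k}"
    for D :: "int set"
  \<comment> \<open>The root \<open>r\<close> and every \<open>v\<close> that the graph on
    \<open>A\<close> can join to it: \<open>v - r + b = d\<close> or \<open>r - v + b = d\<close>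
    with \<open>d\<close> in \<open>D\<close>.\<close>
  define near where
    "near D b r = insert r ((\<lambda>d. r + (d - b)) ` D \<union> (\<lambda>d. r - (d - b)) ` D)"
    for D :: "int set" and b r
  \<comment> \<open>Dominating sets are encoded as lists of length at most \<open>k div 2\<close>,
    which are counted by a sum of powers of \<open>N\<close>.\<close>
  define roots where "roots = {xs. set xs \<subseteq> {1..int N} \<and> length xs \<le> k div 2}"
  define cand where "cand D b xs = Pow (\<Union>r\<in>set xs. near D b r) \<inter> K" for D b xs
  define F where "F D A = (\<lambda>B. (A, B, D)) ` Pow ((\<lambda>x. x - Min A) ` (A + D))"
    for D A :: "int set"
  define cover where
    "cover = (\<Union>D\<in>K. \<Union>b\<in>shifts D. \<Union>xs\<in>roots. \<Union>A\<in>cand D b xs. F D A)"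
  have fin_shifts: "finite (shifts D)" if "D \<in> K" for D
    using that k_subsetsD(1) finite_lists_length_le[of D k]
    by (auto simp: shifts_def K_def)
  have fin_roots: "finite roots"
    using finite_lists_length_le[of "{1..int N}"] by (simp add: roots_def)
  have fin_cand: "finite (cand D b xs)" for D b xs
    by (simp add: cand_def K_def)
  have "?T \<subseteq> cover"
  proof
    fix q assume "q \<in> ?T"
    then obtain A B D where q: "q = (A, B, D)" and ABD: "A \<in> K" "B \<in> K" "D \<in> K"
      and eq: "A + B = A + D" and "B \<noteq> D" by (auto simp: K_def)
    note A = k_subsetsD[OF ABD(1)[unfolded K_def]] and B = k_subsetsD[OF ABD(2)[unfolded K_def]]
      and D = k_subsetsD[OF ABD(3)[unfolded K_def]]
    have "A \<noteq> {}" using A \<open>k \<ge> 1\<close> by auto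
    obtain b where b: "b \<in> B" "b \<notin> D"
      using \<open>B \<noteq> D\<close> card_subset_eq[of D B] B D by auto
    have step: "a + b \<in> A + D" if "a \<in> A" for a
      using that b(1) eq by (metis set_plus_intro)
    have b_in: "b \<in> shifts D"
      using shift_determined[OF A(1) \<open>A \<noteq> {}\<close> step] A(2) by (simp add: shifts_def)
    define E where "E u v \<longleftrightarrow> u - v + b \<in> D \<or> v - u + b \<in> D" for u v
    have E_sym: "E v u" if "E u v" for u v using that by (auto simp: E_def)
    \<comment> \<open>The neighbour differs from \<open>v\<close>, since \<open>a = v\<close> would
      give \<open>d = b\<close>, while \<open>b \<notin> D\<close>.\<close>
    have E_nbr: "\<exists>w\<in>A. w \<noteq> v \<and> E v w" if vA: "v \<in> A" for v
    proof -
      obtain a d where ad: "v + b = a + d" "a \<in> A" "d \<in> D"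
        using step[OF vA] by (blast elim: set_plus_elim)
      then have "v - a + b \<in> D" by (metis add_diff_cancel_left' add_diff_eq diff_add_eq)
      then show "\<exists>w\<in>A. w \<noteq> v \<and> E v w"
        using ad b(2) by (intro bexI[of _ a]) (auto simp: E_def)
    qed
    obtain R where R: "R \<subseteq> A" "2 * card R \<le> card A" "\<And>v. v \<in> A - R \<Longrightarrow> \<exists>r\<in>R. E v r"
      using dominating_set_half[OF A(1) E_sym E_nbr] by blast
    obtain xs where xs: "set xs = R" "distinct xs"
      using finite_distinct_list[of R] R(1) A(1) finite_subset by blast
    then have "length xs \<le> k div 2"
      using R(2) A(2) by (metis distinct_card less_eq_div_iff_mult_less_eq mult.commute pos2)
    then have xs_in: "xs \<in> roots"
      using R(1) A(3) xs by (auto simp: roots_def)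
    have "A \<subseteq> (\<Union>r\<in>set xs. near D b r)"
    proof
      fix v assume v: "v \<in> A"
      show "v \<in> (\<Union>r\<in>set xs. near D b r)"
      proof (cases "v \<in> R")
        case True
        then show ?thesis using xs by (auto simp: near_def)
      next
        case False
        then obtain r where r: "r \<in> R" "E v r" using R(3) v by auto
        from r(2) have "v \<in> near D b r"
          unfolding E_def
        proof
          assume "v - r + b \<in> D"
          then show ?thesis unfolding near_def
            by (intro insertI2 UnI1 image_eqI[of _ _ "v - r + b"]) auto
        next
          assume "r - v + b \<in> D"
          then show ?thesis unfolding near_def
            by (intro insertI2 UnI2 image_eqI[of _ _ "r - v + b"]) auto
        qed
        then show ?thesis using r xs by auto
      qed
    qed
    then have A_in: "A \<in> cand D b xs" using ABD by (simp add: cand_def)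
    \<comment> \<open>The sumset \<open>A + B = A + D\<close> and the shift \<open>Min A\<close> are
      already known, so \<open>B\<close> costs no further power of \<open>N\<close>.\<close>
    have "B \<subseteq> (\<lambda>x. x - Min A) ` (A + D)"
      using subset_shift_sumset[of A B] A(1) \<open>A \<noteq> {}\<close> eq by (simp add: add.commute)
    then have "q \<in> F D A" by (simp add: F_def q)
    then show "q \<in> cover" unfolding cover_def using ABD(3) b_in xs_in A_in by blast
  qed
  moreover have "finite cover"
    unfolding cover_def F_def
    by (intro finite_UN_I fin_shifts fin_roots fin_cand finite_imageI finite_Pow_iff[THEN iffD2]
        finite_set_plus) (auto simp: K_def cand_def dest: k_subsetsD)
  ultimately have "card ?T \<le> card cover" by (rule card_mono[rotated])
  also have "\<dots> \<le> card K * ((\<Sum>i\<le>k. k ^ i) *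
      (((k + 1) * N ^ (k div 2)) * (2 ^ (k * (2 * k + 1)) * 2 ^ (k * k))))"
    unfolding cover_def
  proof (rule card_UN_le_mult)
    show "finite K" by (simp add: K_def)
    fix D assume DK: "D \<in> K"
    note D = k_subsetsD[OF DK[unfolded K_def]]
    have "card (\<Union>b\<in>shifts D. \<Union>xs\<in>roots. \<Union>A\<in>cand D b xs. F D A)
      \<le> card (shifts D) * (((k + 1) * N ^ (k div 2)) * (2 ^ (k * (2 * k + 1)) * 2 ^ (k * k)))"
    proof (rule card_UN_le_mult[OF fin_shifts[OF DK]])
      fix b assume "b \<in> shifts D"
      have "card (\<Union>xs\<in>roots. \<Union>A\<in>cand D b xs. F D A)
        \<le> card roots * (2 ^ (k * (2 * k + 1)) * 2 ^ (k * k))"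
      proof (rule card_UN_le_mult[OF fin_roots])
        fix xs assume xs: "xs \<in> roots"
        have near: "card (near D b r) \<le> 2 * k + 1" "finite (near D b r)" for r
        proof -
          have "card ((\<lambda>d. r + (d - b)) ` D \<union> (\<lambda>d. r - (d - b)) ` D) \<le> k + k"
            using card_Un_le[of "(\<lambda>d. r + (d - b)) ` D" "(\<lambda>d. r - (d - b)) ` D"]
              card_image_le[OF D(1), of "\<lambda>d. r + (d - b)"]
              card_image_le[OF D(1), of "\<lambda>d. r - (d - b)"] D(2) by linarith
          then show "card (near D b r) \<le> 2 * k + 1"
            using card_insert_le_m1[of "2 * k + 1"] by (simp add: near_def mult_2)
          show "finite (near D b r)" using D(1) by (simp add: near_def)
        qed
        have "card (\<Union>r\<in>set xs. near D b r) \<le> card (set xs) * (2 * k + 1)"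
          by (intro card_UN_le_mult near) auto
        also have "\<dots> \<le> k * (2 * k + 1)"
          using xs card_length[of xs] by (intro mult_right_mono) (auto simp: roots_def)
        finally have "card (Pow (\<Union>r\<in>set xs. near D b r)) \<le> 2 ^ (k * (2 * k + 1))"
          using near by (simp add: card_Pow power_increasing)
        moreover have "card (cand D b xs) \<le> card (Pow (\<Union>r\<in>set xs. near D b r))"
          unfolding cand_def using near by (intro card_mono) auto
        ultimately have cand: "card (cand D b xs) \<le> 2 ^ (k * (2 * k + 1))" by linarith
        have "card (\<Union>A\<in>cand D b xs. F D A) \<le> card (cand D b xs) * 2 ^ (k * k)"
        proof (rule card_UN_le_mult[OF fin_cand])
          fix A assume "A \<in> cand D b xs"
          then have AK: "A \<in> k_subsets N k" by (simp add: cand_def K_def)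
          have "card (F D A) \<le> card (Pow ((\<lambda>x. x - Min A) ` (A + D)))"
            unfolding F_def
            using card_shift_sumset_le(2)[OF AK DK[unfolded K_def]] by (intro card_image_le) auto
          then show "card (F D A) \<le> 2 ^ (k * k)"
            using card_Pow_shift_sumset_le[OF AK DK[unfolded K_def]] le_trans by blast
        qed
        also have "\<dots> \<le> 2 ^ (k * (2 * k + 1)) * 2 ^ (k * k)"
          using cand by simp
        finally show "card (\<Union>A\<in>cand D b xs. F D A)
            \<le> 2 ^ (k * (2 * k + 1)) * 2 ^ (k * k)" .
      qed
      also have "\<dots> \<le> ((k + 1) * N ^ (k div 2)) * (2 ^ (k * (2 * k + 1)) * 2 ^ (k * k))"
      proof (rule mult_right_mono)
        have "card roots = (\<Sum>i\<le>k div 2. N ^ i)"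
          unfolding roots_def using card_lists_length_le[of "{1..int N}" "k div 2"] by simp
        also have "\<dots> \<le> (\<Sum>i\<le>k div 2. N ^ (k div 2))"
          using \<open>N \<ge> 1\<close> by (intro sum_mono power_increasing) auto
        also have "\<dots> \<le> (k + 1) * N ^ (k div 2)" by simp
        finally show "card roots \<le> (k + 1) * N ^ (k div 2)" .
      qed simp
      finally show "card (\<Union>xs\<in>roots. \<Union>A\<in>cand D b xs. F D A)
        \<le> ((k + 1) * N ^ (k div 2)) * (2 ^ (k * (2 * k + 1)) * 2 ^ (k * k))" .
    qed
    also have "\<dots> \<le> (\<Sum>i\<le>k. k ^ i) *
        (((k + 1) * N ^ (k div 2)) * (2 ^ (k * (2 * k + 1)) * 2 ^ (k * k)))"
    proof (rule mult_right_mono)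
      have "card (shifts D) \<le> card {ds. set ds \<subseteq> D \<and> length ds \<le> k}"
        unfolding shifts_def using finite_lists_length_le[OF D(1)] by (rule card_image_le)
      then show "card (shifts D) \<le> (\<Sum>i\<le>k. k ^ i)"
        using card_lists_length_le[OF D(1), of k] D(2) by simp
    qed simp
    finally show "card (\<Union>b\<in>shifts D. \<Union>xs\<in>roots. \<Union>A\<in>cand D b xs. F D A)
      \<le> (\<Sum>i\<le>k. k ^ i) * (((k + 1) * N ^ (k div 2)) * (2 ^ (k * (2 * k + 1)) * 2 ^ (k * k)))" .
  qed
  also have "\<dots> \<le> N ^ k * ((\<Sum>i\<le>k. k ^ i) *
      (((k + 1) * N ^ (k div 2)) * (2 ^ (k * (2 * k + 1)) * 2 ^ (k * k))))"
    unfolding K_def by (intro mult_right_mono card_k_subsets_le) simp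
  finally show ?thesis .
qed

subsection \<open>Counting violations of the Sidon property\<close>

text \<open>Quadruples are ordered and may repeat a set. They are sorted below by their number of
  distinct members, on which the probability of lying in the random system depends.\<close>

definition bad_quads :: "nat \<Rightarrow> nat \<Rightarrow> (int set \<times> int set \<times> int set \<times> int set) set" where
  "bad_quads N k = {(A, B, C, D). A \<in> k_subsets N k \<and> B \<in> k_subsets N k \<and> C \<in> k_subsets N k \<and>
     D \<in> k_subsets N k \<and> A + B = C + D \<and> {A, B} \<noteq> {C, D}}"

fun members :: "'a \<times> 'a \<times> 'a \<times> 'a \<Rightarrow> 'a set" where
  "members (A, B, C, D) = {A, B, C, D}"

lemma finite_bad_quads: "finite (bad_quads N k)"
proof (rule finite_subset)
  show "bad_quads N k \<subseteq> k_subsets N k \<times> k_subsets N k \<times> k_subsets N k \<times> k_subsets N k"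
    by (auto simp: bad_quads_def)
qed auto

lemma finite_members [simp]: "finite (members q)"
  by (cases q) auto

lemma card_members_le: "card (members q) \<le> 4"
  by (cases q) (auto simp: card_insert_if)

text \<open>A single member would make \<open>{A, B}\<close> and \<open>{C, D}\<close> the same
  singleton.\<close>

lemma card_members_bad_quads:
  assumes "q \<in> bad_quads N k"
  shows "card (members q) \<in> {2, 3, 4}"
proof -
  have "card (members q) \<noteq> 0" by (cases q) auto
  moreover have "card (members q) \<noteq> 1"
    using assms by (cases q) (auto simp: bad_quads_def card_1_singleton_iff)
  ultimately have "card (members q) = 2 \<or> card (members q) = 3 \<or> card (members q) = 4"
    using card_members_le[of q] by linarith
  then show ?thesis by simp
qed

text \<open>From \<open>2 * Min W = Min C + Min D\<close>, any of the three coincidences forces all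
  minima to agree. Thus no minimum remains to be guessed, which saves the factor \<open>N\<close> of
  the general count.\<close>

lemma subset_shift_double:
  fixes W C D :: "int set"
  assumes "W + W = C + D" "C = D \<or> C = W \<or> D = W"
    and "finite W" "W \<noteq> {}" "finite C" "C \<noteq> {}" "finite D" "D \<noteq> {}"
  shows "{W, C, D} \<subseteq> Pow ((\<lambda>x. x - Min W) ` (W + W))"
proof -
  have "Min W + Min W = Min C + Min D"
    using Min_sumset[of W W] Min_sumset[of C D] assms by metis
  then have "Min C = Min W" "Min D = Min W" using assms(2) by auto
  then show ?thesis
    using subset_shift_sumset[of W W] subset_shift_sumset[of D C] subset_shift_sumset[of C D] assms
    by (auto simp: add.commute)
qed

text \<open>The repeated set on one side serves as \<open>W\<close> in
  \<open>subset_shift_double\<close>. The saving matters: the exponent may not exceed 2\<gamma> = k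
  + 1/2, so \<open>k + 1\<close> would be too large.\<close>

lemma card_bad_quads_2:
  assumes "k \<ge> 1"
  shows "card {q \<in> bad_quads N k. card (members q) = 2} \<le> N ^ k * (2 ^ (k * k)) ^ 4"
    (is "card ?Q \<le> _")
proof -
  define X where "X W = Pow ((\<lambda>x. x - Min W) ` (W + W))" for W :: "int set"
  define F where "F W = X W \<times> X W \<times> X W \<times> X W" for W
  have X: "finite (X W)" "card (X W) \<le> 2 ^ (k * k)" if "W \<in> k_subsets N k" for W
    using card_shift_sumset_le(2)[OF that that] card_Pow_shift_sumset_le[OF that that]
    by (auto simp: X_def)
  have "?Q \<subseteq> (\<Union>W\<in>k_subsets N k. F W)"
  proof
    fix q assume q: "q \<in> ?Q"
    obtain A B C D where q_eq: "q = (A, B, C, D)" by (cases q)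
    have K: "A \<in> k_subsets N k" "B \<in> k_subsets N k" "C \<in> k_subsets N k" "D \<in> k_subsets N k"
      and eq: "A + B = C + D" and ne: "{A, B} \<noteq> {C, D}" and two: "card {A, B, C, D} = 2"
      using q by (auto simp: q_eq bad_quads_def)
    have *: "finite Y \<and> Y \<noteq> {}" if "Y \<in> k_subsets N k" for Y
      using k_subsetsD[OF that] \<open>k \<ge> 1\<close> by auto
    obtain U V where "{A, B, C, D} = {U, V}" using two by (auto simp: card_2_iff)
    then have UV: "A \<in> {U, V}" "B \<in> {U, V}" "C \<in> {U, V}" "D \<in> {U, V}" by blast+
    \<comment> \<open>Otherwise both sides would be the whole pair \<open>{U, V}\<close>, contrary
      to \<open>ne\<close>.\<close>
    consider "A = B" | "C = D" using UV ne by fastforce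
    then show "q \<in> (\<Union>W\<in>k_subsets N k. F W)"
    proof cases
      case 1
      have "C = D \<or> C = A \<or> D = A" using UV by auto
      then have "{A, C, D} \<subseteq> X A"
        unfolding X_def using subset_shift_double[of A C D] eq 1 K * by blast
      then show ?thesis using K 1 by (auto simp: F_def q_eq)
    next
      case 2
      have "A = B \<or> A = C \<or> B = C" using UV by auto
      then have "{C, A, B} \<subseteq> X C"
        unfolding X_def using subset_shift_double[of C A B] eq 2 K * by (metis (no_types))
      then show ?thesis using K 2 by (auto simp: F_def q_eq)
    qed
  qed
  moreover have "finite (\<Union>W\<in>k_subsets N k. F W)" using X by (auto simp: F_def)
  ultimately have "card ?Q \<le> card (\<Union>W\<in>k_subsets N k. F W)" by (rule card_mono[rotated])
  also have "\<dots> \<le> card (k_subsets N k) * (2 ^ (k * k)) ^ 4"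
  proof (rule card_UN_le_mult)
    fix W assume "W \<in> k_subsets N k"
    then have "card (X W) ^ 4 \<le> (2 ^ (k * k)) ^ 4" using X(2) by (intro power_mono) auto
    then show "card (F W) \<le> (2 ^ (k * k)) ^ 4"
      by (simp add: F_def card_cartesian_product power4_eq_xxxx mult.assoc)
  qed simp
  also have "\<dots> \<le> N ^ k * (2 ^ (k * k)) ^ 4"
    by (intro mult_right_mono card_k_subsets_le) simp
  finally show ?thesis .
qed

text \<open>The general count over all pairs \<open>(A, B)\<close> gives the exponent
  \<open>2 * k + 1\<close>, which is exactly 4\<gamma>.\<close>

lemma card_bad_quads_4:
  assumes "k \<ge> 1"
  shows "card {q \<in> bad_quads N k. card (members q) = 4} \<le>
    N ^ (2 * k + 1) * (2 ^ (k * k) * 2 ^ (k * k))"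
proof -
  let ?K = "k_subsets N k"
  let ?Q = "{(A, B, C, D). (A, B) \<in> ?K \<times> ?K \<and> C \<in> ?K \<and> D \<in> ?K \<and> A + B = C + D}"
  have fin: "finite ?Q"
    by (rule finite_subset[of _ "?K \<times> ?K \<times> ?K \<times> ?K"]) auto
  have "card {q \<in> bad_quads N k. card (members q) = 4} \<le> card ?Q"
    by (rule card_mono[OF fin]) (auto simp: bad_quads_def)
  also have "\<dots> \<le> card (?K \<times> ?K) * (N * (2 ^ (k * k) * 2 ^ (k * k)))"
    by (rule card_equal_sumsets_le[OF _ assms]) auto
  also have "\<dots> \<le> (N ^ k * N ^ k) * (N * (2 ^ (k * k) * 2 ^ (k * k)))"
    unfolding card_cartesian_product
    by (intro mult_right_mono mult_mono card_k_subsets_le) auto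
  also have "\<dots> = N ^ (2 * k + 1) * (2 ^ (k * k) * 2 ^ (k * k))"
    by (simp add: mult_2 power_add)
  finally show ?thesis .
qed

text \<open>Two of the four entries coincide. If they are on the same side, the general count over
  the diagonal gives \<open>N ^ (k + 1)\<close>; if they are on opposite sides, there is a common
  summand and the count is of order \<open>N ^ (k + k div 2)\<close>.\<close>

lemma card_bad_quads_3:
  assumes "k \<ge> 1"
  obtains c where "\<And>N. N \<ge> 1 \<Longrightarrow> card {q \<in> bad_quads N k. card (members q) = 3} \<le>
    c * (N ^ (k + 1) + N ^ (k + k div 2))"
proof -
  define c1 where "c1 = 2 ^ (k * k) * (2 :: nat) ^ (k * k)"
  define c2 where "c2 = (\<Sum>i\<le>k. k ^ i) * (k + 1) * (2 ^ (k * (2 * k + 1)) * 2 ^ (k * k))"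
  have "card {q \<in> bad_quads N k. card (members q) = 3} \<le>
      (2 * c1 + 4 * c2) * (N ^ (k + 1) + N ^ (k + k div 2))" if "N \<ge> 1" for N
  proof -
    let ?K = "k_subsets N k"
    define S where "S = (\<lambda>W. (W, W)) ` ?K"
    define Q where "Q = {(A, B, C, D). (A, B) \<in> S \<and> C \<in> ?K \<and> D \<in> ?K \<and> A + B = C + D}"
    define T where "T = {(A, B, D). A \<in> ?K \<and> B \<in> ?K \<and> D \<in> ?K \<and> A + B = A + D \<and> B \<noteq> D}"
    \<comment> \<open>The map \<open>h\<close> swaps the two sides; \<open>g1\<close> to
      \<open>g4\<close> place the common summand in its four possible positions.\<close>
    define h where "h = (\<lambda>(A, B, C, D). (C, D, A, B) :: int set \<times> int set \<times> int set \<times> int set)"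
    define g1 where "g1 = (\<lambda>(A, B, D). (A, B, A, D) :: int set \<times> int set \<times> int set \<times> int set)"
    define g2 where "g2 = (\<lambda>(A, B, D). (A, B, D, A) :: int set \<times> int set \<times> int set \<times> int set)"
    define g3 where "g3 = (\<lambda>(A, B, D). (B, A, A, D) :: int set \<times> int set \<times> int set \<times> int set)"
    define g4 where "g4 = (\<lambda>(A, B, D). (B, A, D, A) :: int set \<times> int set \<times> int set \<times> int set)"
    have fin: "finite Q" "finite T"
      by (rule finite_subset[of _ "?K \<times> ?K \<times> ?K \<times> ?K"], auto simp: Q_def S_def)
        (rule finite_subset[of _ "?K \<times> ?K \<times> ?K"], auto simp: T_def)
    have "{q \<in> bad_quads N k. card (members q) = 3} \<subseteq>
        Q \<union> h ` Q \<union> g1 ` T \<union> g2 ` T \<union> g3 ` T \<union> g4 ` T"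
    proof
      fix q assume q: "q \<in> {q \<in> bad_quads N k. card (members q) = 3}"
      obtain A B C D where q_eq: "q = (A, B, C, D)" by (cases q)
      have K: "A \<in> ?K" "B \<in> ?K" "C \<in> ?K" "D \<in> ?K"
        and eq: "A + B = C + D" and ne: "{A, B} \<noteq> {C, D}" and three: "card {A, B, C, D} = 3"
        using q by (auto simp: q_eq bad_quads_def)
      have "\<not> (A \<noteq> B \<and> A \<noteq> C \<and> A \<noteq> D \<and> B \<noteq> C \<and> B \<noteq> D \<and> C \<noteq> D)"
      proof
        assume "A \<noteq> B \<and> A \<noteq> C \<and> A \<noteq> D \<and> B \<noteq> C \<and> B \<noteq> D \<and> C \<noteq> D"
        then have "card {A, B, C, D} = 4" by simp
        then show False using three by simp
      qed
      then consider "A = B" | "C = D" | "A = C" | "A = D" | "B = C" | "B = D" by blast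
      then show "q \<in> Q \<union> h ` Q \<union> g1 ` T \<union> g2 ` T \<union> g3 ` T \<union> g4 ` T"
      proof cases
        case 1
        then have "q \<in> Q" using K eq by (auto simp: Q_def S_def q_eq)
        then show ?thesis by simp
      next
        case 2
        then have "(C, D, A, B) \<in> Q" using K eq by (auto simp: Q_def S_def)
        then have "q \<in> h ` Q" by (force simp: h_def q_eq)
        then show ?thesis by simp
      next
        case 3
        then have "(A, B, D) \<in> T" using K eq ne by (auto simp: T_def)
        then have "q \<in> g1 ` T" using 3 by (force simp: g1_def q_eq)
        then show ?thesis by simp
      next
        case 4
        then have "(A, B, C) \<in> T" using K eq ne by (auto simp: T_def add.commute)
        then have "q \<in> g2 ` T" using 4 by (force simp: g2_def q_eq)
        then show ?thesis by simp
      next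
        case 5
        then have "(B, A, D) \<in> T" using K eq ne by (auto simp: T_def add.commute)
        then have "q \<in> g3 ` T" using 5 by (force simp: g3_def q_eq)
        then show ?thesis by simp
      next
        case 6
        then have "(B, A, C) \<in> T" using K eq ne by (auto simp: T_def add.commute)
        then have "q \<in> g4 ` T" using 6 by (force simp: g4_def q_eq)
        then show ?thesis by simp
      qed
    qed
    then have "card {q \<in> bad_quads N k. card (members q) = 3} \<le>
        card (Q \<union> h ` Q \<union> g1 ` T \<union> g2 ` T \<union> g3 ` T \<union> g4 ` T)"
      using fin by (intro card_mono) auto
    also have "\<dots> \<le> card Q + card (h ` Q) + card (g1 ` T) + card (g2 ` T) + card (g3 ` T) + card (g4 ` T)"
      by (meson add_le_mono1 card_Un_le order_trans)
    also have "\<dots> \<le> 2 * card Q + 4 * card T"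
      using card_image_le[OF fin(1), of h] card_image_le[OF fin(2), of g1]
        card_image_le[OF fin(2), of g2] card_image_le[OF fin(2), of g3]
        card_image_le[OF fin(2), of g4] by linarith
    also have "\<dots> \<le> 2 * (c1 * N ^ (k + 1)) + 4 * (c2 * N ^ (k + k div 2))"
    proof (intro add_mono mult_left_mono)
      have "card Q \<le> card S * (N * (2 ^ (k * k) * 2 ^ (k * k)))"
        unfolding Q_def by (rule card_equal_sumsets_le[OF _ assms]) (auto simp: S_def)
      also have "\<dots> \<le> N ^ k * (N * (2 ^ (k * k) * 2 ^ (k * k)))"
        using card_image_le[of ?K "\<lambda>W. (W, W)"] card_k_subsets_le[of N k]
        by (intro mult_right_mono) (auto simp: S_def)
      finally show "card Q \<le> c1 * N ^ (k + 1)" by (simp add: c1_def algebra_simps)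
      have "card T \<le> N ^ k * ((\<Sum>i\<le>k. k ^ i) *
          (((k + 1) * N ^ (k div 2)) * (2 ^ (k * (2 * k + 1)) * 2 ^ (k * k))))"
        unfolding T_def by (rule card_common_summand_le[OF assms that])
      also have "\<dots> = c2 * N ^ (k + k div 2)"
        by (simp only: c2_def power_add mult_ac)
      finally show "card T \<le> c2 * N ^ (k + k div 2)" .
    qed auto
    also have "\<dots> \<le> (2 * c1 + 4 * c2) * (N ^ (k + 1) + N ^ (k + k div 2))"
      by (simp add: algebra_simps)
    finally show ?thesis .
  qed
  then show thesis by (rule that)
qed

lemma power_le_powr:
  assumes "N \<ge> 1" "real e \<le> x"
  shows "real (N ^ e) \<le> real N powr x"
  using assms powr_mono[of "real e" x "real N"] by (simp add: powr_realpow)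

text \<open>The exponents fit: \<open>k\<close> is at most 2\<gamma>, both \<open>k + 1\<close> and
  \<open>k + k div 2\<close> are at most 3\<gamma> (the first because \<open>k \<ge> 1\<close>), and
  \<open>2 * k + 1\<close> equals 4\<gamma>. Adding the three constants gives one \<open>c\<close>
  for all \<open>s\<close>.\<close>

lemma card_bad_quads:
  assumes "k \<ge> 1"
  obtains c where "c \<ge> 0" and "\<And>N s. N \<ge> 1 \<Longrightarrow> s \<in> {2, 3, 4} \<Longrightarrow>
    real (card {q \<in> bad_quads N k. card (members q) = s}) \<le>
      c * real N powr (real s * ((2 * real k + 1) / 4))"
proof -
  obtain c3 where c3: "\<And>N. N \<ge> 1 \<Longrightarrow> card {q \<in> bad_quads N k. card (members q) = 3} \<le>
    c3 * (N ^ (k + 1) + N ^ (k + k div 2))"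
    using card_bad_quads_3[OF assms] by blast
  define c where "c = real ((2 ^ (k * k)) ^ 4 + 2 * c3 + 2 ^ (k * k) * 2 ^ (k * k))"
  have "real (card {q \<in> bad_quads N k. card (members q) = s}) \<le>
      c * real N powr (real s * ((2 * real k + 1) / 4))" if N: "N \<ge> 1" and s: "s \<in> {2, 3, 4}" for N s
  proof -
    let ?g = "real N powr (real s * ((2 * real k + 1) / 4))"
    have "\<exists>c'. real (card {q \<in> bad_quads N k. card (members q) = s}) \<le> c' * ?g \<and> c' \<le> c"
      using s
    proof (elim insertE emptyE)
      assume s: "s = 2"
      have "real (card {q \<in> bad_quads N k. card (members q) = s}) \<le> real (N ^ k * (2 ^ (k * k)) ^ 4)"
        unfolding s of_nat_le_iff by (rule card_bad_quads_2[OF assms])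
      also have "\<dots> = real ((2 ^ (k * k)) ^ 4) * real (N ^ k)" by simp
      also have "\<dots> \<le> real ((2 ^ (k * k)) ^ 4) * ?g"
        by (intro mult_left_mono power_le_powr N) (auto simp: s)
      finally show ?thesis
        by (intro exI[of _ "real ((2 ^ (k * k)) ^ 4)"]) (auto simp: c_def)
    next
      assume s: "s = 3"
      have "real (card {q \<in> bad_quads N k. card (members q) = s}) \<le>
          real (c3 * (N ^ (k + 1) + N ^ (k + k div 2)))"
        unfolding s of_nat_le_iff by (rule c3[OF N])
      also have "\<dots> = real c3 * (real (N ^ (k + 1)) + real (N ^ (k + k div 2)))" by simp
      also have "\<dots> \<le> real c3 * (?g + ?g)"
        using assms by (intro mult_left_mono add_mono power_le_powr N) (auto simp: s)
      finally show ?thesis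
        by (intro exI[of _ "real (2 * c3)"]) (auto simp: c_def)
    next
      assume s: "s = 4"
      have "real (card {q \<in> bad_quads N k. card (members q) = s}) \<le>
          real (N ^ (2 * k + 1) * (2 ^ (k * k) * 2 ^ (k * k)))"
        unfolding s of_nat_le_iff by (rule card_bad_quads_4[OF assms])
      also have "\<dots> = real (2 ^ (k * k) * 2 ^ (k * k)) * real (N ^ (2 * k + 1))" by simp
      also have "\<dots> \<le> real (2 ^ (k * k) * 2 ^ (k * k)) * ?g"
        by (intro mult_left_mono power_le_powr N) (auto simp: s)
      finally show ?thesis
        by (intro exI[of _ "real (2 ^ (k * k) * 2 ^ (k * k))"]) (auto simp: c_def)
    qed
    then show ?thesis by (meson mult_right_mono order_trans powr_ge_zero)
  qed
  moreover have "c \<ge> 0" by (simp add: c_def)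
  ultimately show thesis using that by blast
qed

lemma sidon_systemD:
  assumes "sidon_system \<A>" "A \<in> \<A>" "B \<in> \<A>" "C \<in> \<A>" "D \<in> \<A>" "A + B = C + D"
  shows "{A, B} = {C, D}"
  using assms(1)[unfolded sidon_system_def, THEN bspec, OF assms(2), THEN bspec, OF assms(3),
      THEN bspec, OF assms(4), THEN bspec, OF assms(5)] assms(6) by (rule mp)

lemma not_sidon_systemE:
  assumes "\<not> sidon_system \<A>" "\<A> \<subseteq> k_subsets N k"
  obtains q where "q \<in> bad_quads N k" "members q \<subseteq> \<A>"
proof -
  obtain A B C D where "A \<in> \<A>" "B \<in> \<A>" "C \<in> \<A>" "D \<in> \<A>" "A + B = C + D" "{A, B} \<noteq> {C, D}"
    using assms(1) unfolding sidon_system_def by blast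
  then have "(A, B, C, D) \<in> bad_quads N k" "members (A, B, C, D) \<subseteq> \<A>"
    using assms(2) by (auto simp only: bad_quads_def members.simps)
  then show thesis by (rule that)
qed

subsection \<open>Below the threshold\<close>

text \<open>The event is a product of conditions on independent trials: success on \<open>Q\<close>,
  no restriction elsewhere.\<close>

lemma prob_random_system_superset:
  assumes "Q \<subseteq> k_subsets N k" "0 \<le> p" "p \<le> 1"
  shows "measure_pmf.prob (random_system N k p) {\<A>. Q \<subseteq> \<A>} = p ^ card Q"
proof -
  let ?K = "k_subsets N k"
  have "measure_pmf.prob (random_system N k p) {\<A>. Q \<subseteq> \<A>} =
      measure_pmf.prob (Pi_pmf ?K False (\<lambda>_. bernoulli_pmf p))
        (Pi ?K (\<lambda>A. if A \<in> Q then {True} else UNIV))"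
    unfolding random_system_def measure_map_pmf
    using assms(1) by (intro arg_cong[where f = "measure_pmf.prob _"]) (auto split: if_splits)
  also have "\<dots> = (\<Prod>A\<in>?K. measure_pmf.prob (bernoulli_pmf p) (if A \<in> Q then {True} else UNIV))"
    by (rule measure_Pi_pmf_Pi) simp
  also have "\<dots> = (\<Prod>A\<in>?K. if A \<in> Q then p else 1)"
    using assms by (intro prod.cong) (auto simp: measure_pmf_single)
  also have "\<dots> = p ^ card Q"
    using assms(1) by (simp add: prod.If_cases Int_absorb1)
  finally show ?thesis .
qed

lemma set_random_system: "\<A> \<in> set_pmf (random_system N k p) \<Longrightarrow> \<A> \<subseteq> k_subsets N k"
  by (auto simp: random_system_def)

text \<open>Union bound over bad quadruples, grouped by their number of distinct members.\<close>

lemma prob_not_sidon_le: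
  assumes "0 \<le> p" "p \<le> 1"
  shows "1 - measure_pmf.prob (random_system N k p) {\<A>. sidon_system \<A>} \<le>
    (\<Sum>s\<in>{2, 3, 4}. real (card {q \<in> bad_quads N k. card (members q) = s}) * p ^ s)"
proof -
  let ?M = "random_system N k p"
  have "1 - measure_pmf.prob ?M {\<A>. sidon_system \<A>} = measure_pmf.prob ?M {\<A>. \<not> sidon_system \<A>}"
    using measure_pmf.prob_compl[of "{\<A>. sidon_system \<A>}" ?M] by (simp add: Compl_eq_Diff_UNIV[symmetric] Collect_neg_eq)
  also have "\<dots> \<le> measure_pmf.prob ?M (\<Union>q\<in>bad_quads N k. {\<A>. members q \<subseteq> \<A>})"
  \<comment> \<open>The inclusion of events holds only on the support, where the members of the
    family are \<open>k\<close>-subsets of the interval; hence the almost-everywhere form.\<close>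
  proof (rule measure_pmf.finite_measure_mono_AE)
    show "AE \<A> in measure_pmf ?M. \<A> \<in> {\<A>. \<not> sidon_system \<A>} \<longrightarrow>
        \<A> \<in> (\<Union>q\<in>bad_quads N k. {\<A>. members q \<subseteq> \<A>})"
      unfolding AE_measure_pmf_iff
    proof (intro ballI impI)
      fix \<A> assume "\<A> \<in> set_pmf ?M" "\<A> \<in> {\<A>. \<not> sidon_system \<A>}"
      then show "\<A> \<in> (\<Union>q\<in>bad_quads N k. {\<A>. members q \<subseteq> \<A>})"
        using not_sidon_systemE set_random_system by (metis (mono_tags) UN_I mem_Collect_eq)
    qed
  qed simp
  also have "\<dots> \<le> (\<Sum>q\<in>bad_quads N k. measure_pmf.prob ?M {\<A>. members q \<subseteq> \<A>})"
    by (rule measure_pmf.finite_measure_subadditive_finite) (auto simp: finite_bad_quads)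
  also have "\<dots> = (\<Sum>q\<in>bad_quads N k. p ^ card (members q))"
    using assms by (intro sum.cong prob_random_system_superset) (auto simp: bad_quads_def)
  also have "\<dots> = (\<Sum>s\<in>{2, 3, 4}. \<Sum>q | q \<in> bad_quads N k \<and> card (members q) = s. p ^ card (members q))"
    by (rule sum.group[symmetric, OF finite_bad_quads _ image_subsetI[OF card_members_bad_quads]]) simp
  also have "\<dots> = (\<Sum>s\<in>{2, 3, 4}. real (card {q \<in> bad_quads N k. card (members q) = s}) * p ^ s)"
    by (intro sum.cong) auto
  finally show ?thesis .
qed

text \<open>With \<open>r\<close> the ratio of \<open>p\<close> to the threshold, the quadruples
  with \<open>s\<close> members contribute at most \<open>c * r N ^ s\<close>, which tends to
  0.\<close>

lemma prob_sidon_tendsto_1: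
  fixes p :: "nat \<Rightarrow> real"
  assumes "k \<ge> 1" and p: "\<And>N. N > k \<Longrightarrow> 0 < p N \<and> p N \<le> 1"
    and small: "p \<in> o(\<lambda>N. real N powr (- (2 * real k + 1) / 4))"
  shows "(\<lambda>N. measure_pmf.prob (random_system N k (p N)) {\<A>. sidon_system \<A>}) \<longlonglongrightarrow> 1"
proof -
  define \<gamma> where "\<gamma> = (2 * real k + 1) / 4"
  define r where "r N = p N / real N powr (- \<gamma>)" for N
  have "- (2 * real k + 1) / 4 = - \<gamma>" unfolding \<gamma>_def by linarith
  then have r0: "r \<longlonglongrightarrow> 0"
    using smalloD_tendsto[OF small] unfolding r_def by simp
  obtain c where "c \<ge> 0" and c: "\<And>N s. N \<ge> 1 \<Longrightarrow> s \<in> {2, 3, 4} \<Longrightarrow>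
      real (card {q \<in> bad_quads N k. card (members q) = s}) \<le> c * real N powr (real s * \<gamma>)"
    using card_bad_quads[OF assms(1)] unfolding \<gamma>_def by blast
  have bound: "1 - measure_pmf.prob (random_system N k (p N)) {\<A>. sidon_system \<A>} \<le>
      (\<Sum>s\<in>{2, 3, 4}. c * r N ^ s)" if "N > k" for N
  proof -
    have N: "N \<ge> 1" "0 \<le> p N" "p N \<le> 1" using that p[OF that] by auto
    have "1 - measure_pmf.prob (random_system N k (p N)) {\<A>. sidon_system \<A>} \<le>
        (\<Sum>s\<in>{2, 3, 4}. real (card {q \<in> bad_quads N k. card (members q) = s}) * p N ^ s)"
      by (rule prob_not_sidon_le[OF N(2,3)])
    also have "\<dots> \<le> (\<Sum>s\<in>{2, 3, 4}. c * r N ^ s)"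
    proof (rule sum_mono)
      fix s :: nat assume "s \<in> {2, 3, 4}"
      then have "real (card {q \<in> bad_quads N k. card (members q) = s}) * p N ^ s
          \<le> (c * real N powr (real s * \<gamma>)) * p N ^ s"
        using N by (intro mult_right_mono c) auto
      also have "real N powr (real s * \<gamma>) = (real N powr \<gamma>) ^ s"
        using N by (simp add: powr_power)
      also have "c * (real N powr \<gamma>) ^ s * p N ^ s = c * r N ^ s"
        by (simp add: r_def powr_minus power_mult_distrib divide_inverse mult_ac)
      finally show "real (card {q \<in> bad_quads N k. card (members q) = s}) * p N ^ s \<le> c * r N ^ s" .
    qed
    finally show ?thesis .
  qed
  have lim: "(\<lambda>N. 1 - (\<Sum>s\<in>{2, 3, 4}. c * r N ^ s)) \<longlonglongrightarrow> 1"
    by (auto intro!: tendsto_eq_intros r0)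
  show ?thesis
  proof (rule tendsto_sandwich[OF _ _ lim tendsto_const])
    show "\<forall>\<^sub>F N in sequentially. 1 - (\<Sum>s\<in>{2, 3, 4}. c * r N ^ s) \<le>
        measure_pmf.prob (random_system N k (p N)) {\<A>. sidon_system \<A>}"
      using eventually_gt_at_top[of k]
    proof eventually_elim
      case (elim N)
      show ?case using bound[OF elim] by linarith
    qed
  qed simp
qed

subsection \<open>Above the threshold\<close>

text \<open>
  Chebyshev's inequality for the number of \<open>x\<close> with \<open>Q x \<subseteq> \<A>\<close>; pairs \<open>x, y\<close> contribute
  to the variance only if \<open>R = Q x \<inter> Q y\<close> is nonempty.
\<close>

lemma second_moment_bound:
  fixes M :: "'a set pmf" and Q :: "'i \<Rightarrow> 'a set" and p \<delta> :: real
  assumes fin: "finite P" "P \<noteq> {}" and p: "0 < p"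
    and Q: "\<And>x. x \<in> P \<Longrightarrow> Q x \<subseteq> U" "\<And>x. x \<in> P \<Longrightarrow> finite (Q x)" "\<And>x. x \<in> P \<Longrightarrow> card (Q x) = m"
    and prob: "\<And>S. S \<subseteq> U \<Longrightarrow> finite S \<Longrightarrow> measure_pmf.prob M {\<A>. S \<subseteq> \<A>} = p ^ card S"
    and deg: "\<And>R. R \<noteq> {} \<Longrightarrow> finite R \<Longrightarrow> card R \<le> m \<Longrightarrow>
      real (card {y \<in> P. R \<subseteq> Q y}) \<le> \<delta> * real (card P) * p ^ card R"
  shows "measure_pmf.prob M {\<A>. \<forall>x\<in>P. \<not> Q x \<subseteq> \<A>} \<le> (2 ^ m - 1) * \<delta>"
proof -
  define ind where "ind S = (indicator {\<A>. S \<subseteq> \<A>} :: 'a set \<Rightarrow> real)" for S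
  define \<mu> where "\<mu> = real (card P) * p ^ m"
  have \<mu>: "\<mu> > 0" using fin p by (simp add: \<mu>_def card_gt_0_iff)
  have cardP: "real (card P) > 0" using fin by (simp add: card_gt_0_iff)
  have ind_mult: "ind S \<A> * ind T \<A> = ind (S \<union> T) \<A>" for S T \<A>
    by (auto simp: ind_def indicator_def)
  have int: "integrable (measure_pmf M) (ind S)" for S
    unfolding ind_def by (rule integrable_real_indicator) (auto simp: measure_pmf.emeasure_eq_measure)
  have exp: "(\<integral>\<A>. ind S \<A> \<partial>M) = p ^ card S" if "S \<subseteq> U" "finite S" for S
    using prob[OF that] by (simp add: ind_def)
  \<comment> \<open>For disjoint \<open>Q x\<close>, \<open>Q y\<close> the left side vanishes.
    Otherwise the single term \<open>R = Q x \<inter> Q y\<close> suffices; summing over all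
    nonempty \<open>R\<close> allows the sums to be exchanged later.\<close>
  have overlap: "p ^ card (Q x \<union> Q y) - p ^ (2 * m) \<le>
      p ^ (2 * m) * (\<Sum>R\<in>Pow (Q x) - {{}}. if R \<subseteq> Q y then 1 / p ^ card R else 0)"
    if "x \<in> P" "y \<in> P" for x y
  proof -
    have card: "card (Q x \<union> Q y) + card (Q x \<inter> Q y) = 2 * m"
      using card_Un_Int[of "Q x" "Q y"] Q that by simp
    have nonneg: "0 \<le> (if R \<subseteq> Q y then 1 / p ^ card R else 0)" for R
      using p by simp
    show ?thesis
    proof (cases "Q x \<inter> Q y = {}")
      case True
      then have "p ^ card (Q x \<union> Q y) - p ^ (2 * m) = 0" using card by simp
      also have "\<dots> \<le> p ^ (2 * m) * (\<Sum>R\<in>Pow (Q x) - {{}}. if R \<subseteq> Q y then 1 / p ^ card R else 0)"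
        using p nonneg by (intro mult_nonneg_nonneg sum_nonneg) auto
      finally show ?thesis .
    next
      case False
      have "p ^ card (Q x \<union> Q y) = p ^ (2 * m) * (1 / p ^ card (Q x \<inter> Q y))"
        using p by (simp add: card[symmetric] power_add)
      also have "1 / p ^ card (Q x \<inter> Q y) =
          (\<Sum>R\<in>{Q x \<inter> Q y}. if R \<subseteq> Q y then 1 / p ^ card R else 0)"
        by simp
      also have "p ^ (2 * m) * \<dots> \<le>
          p ^ (2 * m) * (\<Sum>R\<in>Pow (Q x) - {{}}. if R \<subseteq> Q y then 1 / p ^ card R else 0)"
        using p nonneg False Q(2)[OF that(1)] by (intro mult_left_mono sum_mono2) auto
      finally show ?thesis using p by (smt (verit) zero_less_power)
    qed
  qed
  have "measure_pmf.prob M {\<A>. \<forall>x\<in>P. \<not> Q x \<subseteq> \<A>} * \<mu>\<^sup>2 =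
      (\<integral>\<A>. indicator {\<A>. \<forall>x\<in>P. \<not> Q x \<subseteq> \<A>} \<A> * \<mu>\<^sup>2 \<partial>M)"
    by simp
  \<comment> \<open>The right integrand is the expanded square of the count minus
    \<open>\<mu>\<close>. On the event the count is 0, so the square equals
    \<open>\<mu>\<^sup>2\<close>.\<close>
  also have "\<dots> \<le> (\<integral>\<A>. (\<Sum>x\<in>P. \<Sum>y\<in>P. ind (Q x \<union> Q y) \<A>) - 2 * \<mu> * (\<Sum>x\<in>P. ind (Q x) \<A>) + \<mu>\<^sup>2 \<partial>M)"
  proof (rule integral_mono)
    show "integrable (measure_pmf M) (\<lambda>\<A>. indicator {\<A>. \<forall>x\<in>P. \<not> Q x \<subseteq> \<A>} \<A> * \<mu>\<^sup>2)"
      by (intro integrable_mult_left integrable_real_indicator) (auto simp: measure_pmf.emeasure_eq_measure)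
    show "integrable (measure_pmf M)
        (\<lambda>\<A>. (\<Sum>x\<in>P. \<Sum>y\<in>P. ind (Q x \<union> Q y) \<A>) - 2 * \<mu> * (\<Sum>x\<in>P. ind (Q x) \<A>) + \<mu>\<^sup>2)"
      by (intro Bochner_Integration.integrable_add Bochner_Integration.integrable_diff
          Bochner_Integration.integrable_sum integrable_mult_right int measure_pmf.integrable_const)
    fix \<A>
    have "(\<Sum>x\<in>P. \<Sum>y\<in>P. ind (Q x \<union> Q y) \<A>) - 2 * \<mu> * (\<Sum>x\<in>P. ind (Q x) \<A>) + \<mu>\<^sup>2 =
        ((\<Sum>x\<in>P. ind (Q x) \<A>) - \<mu>)\<^sup>2"
      by (simp add: ind_mult[symmetric] sum_product[symmetric] power2_eq_square algebra_simps)
    moreover have "(\<Sum>x\<in>P. ind (Q x) \<A>) = 0" if "\<forall>x\<in>P. \<not> Q x \<subseteq> \<A>"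
      using that by (intro sum.neutral) (auto simp: ind_def)
    ultimately show "indicator {\<A>. \<forall>x\<in>P. \<not> Q x \<subseteq> \<A>} \<A> * \<mu>\<^sup>2 \<le>
        (\<Sum>x\<in>P. \<Sum>y\<in>P. ind (Q x \<union> Q y) \<A>) - 2 * \<mu> * (\<Sum>x\<in>P. ind (Q x) \<A>) + \<mu>\<^sup>2"
      by (cases "\<forall>x\<in>P. \<not> Q x \<subseteq> \<A>") auto
  qed
  also have "\<dots> = (\<Sum>x\<in>P. \<Sum>y\<in>P. p ^ card (Q x \<union> Q y)) - 2 * \<mu> * (\<Sum>x\<in>P. p ^ card (Q x)) + \<mu>\<^sup>2"
    using Q(1,2) by (simp add: int exp Bochner_Integration.integral_sum)
  also have "\<dots> = (\<Sum>x\<in>P. \<Sum>y\<in>P. p ^ card (Q x \<union> Q y)) - \<mu>\<^sup>2"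
    using Q(3) by (simp add: \<mu>_def power2_eq_square)
  also have "\<dots> = (\<Sum>x\<in>P. \<Sum>y\<in>P. p ^ card (Q x \<union> Q y) - p ^ (2 * m))"
    by (simp add: sum_subtractf \<mu>_def power2_eq_square mult_2 power_add)
  also have "\<dots> \<le> (\<Sum>x\<in>P. \<Sum>y\<in>P. p ^ (2 * m) *
      (\<Sum>R\<in>Pow (Q x) - {{}}. if R \<subseteq> Q y then 1 / p ^ card R else 0))"
    by (intro sum_mono overlap)
  \<comment> \<open>After the exchange, the sum over \<open>y\<close> counts the \<open>y\<close>
    with \<open>R \<subseteq> Q y\<close>, to which \<open>deg\<close> applies.\<close>
  also have "\<dots> = p ^ (2 * m) * (\<Sum>x\<in>P. \<Sum>R\<in>Pow (Q x) - {{}}. \<Sum>y\<in>P. if R \<subseteq> Q y then 1 / p ^ card R else 0)"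
    by (simp add: sum_distrib_left[symmetric] sum.swap[of _ P "Pow _ - _"])
  also have "\<dots> \<le> p ^ (2 * m) * (\<Sum>x\<in>P. \<Sum>R\<in>Pow (Q x) - {{}}. \<delta> * real (card P))"
  proof (intro mult_left_mono sum_mono)
    fix x R assume x: "x \<in> P" and R: "R \<in> Pow (Q x) - {{}}"
    then have R': "finite R" "card R \<le> m"
      using Q(2,3)[OF x] finite_subset card_mono by (blast, metis DiffD1 Pow_iff card_mono)
    have "(\<Sum>y\<in>P. if R \<subseteq> Q y then 1 / p ^ card R else 0) = real (card {y \<in> P. R \<subseteq> Q y}) / p ^ card R"
      using fin by (simp add: sum.If_cases Int_def)
    also have "\<dots> \<le> \<delta> * real (card P)"
      using deg[of R] R R' p by (simp add: divide_le_eq)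
    finally show "(\<Sum>y\<in>P. if R \<subseteq> Q y then 1 / p ^ card R else 0) \<le> \<delta> * real (card P)" .
  qed (use p in auto)
  also have "\<dots> = p ^ (2 * m) * (real (card P) * (real (2 ^ m - 1) * (\<delta> * real (card P))))"
  proof -
    have "(\<Sum>R\<in>Pow (Q x) - {{}}. \<delta> * real (card P)) = real (2 ^ m - 1) * (\<delta> * real (card P))"
      if "x \<in> P" for x
      using Q(2,3)[OF that] by (simp add: card_Pow card_Diff_subset)
    then have "(\<Sum>x\<in>P. \<Sum>R\<in>Pow (Q x) - {{}}. \<delta> * real (card P)) =
        (\<Sum>x\<in>P. real (2 ^ m - 1) * (\<delta> * real (card P)))"
      by (rule sum.cong[OF refl])
    then show ?thesis by (simp only: sum_constant)
  qed
  also have "\<dots> = real (2 ^ m - 1) * \<delta> * \<mu>\<^sup>2"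
    by (simp add: \<mu>_def power2_eq_square mult_2 power_add)
  finally show ?thesis using \<mu> by (simp add: of_nat_diff)
qed

section \<open>Parallelograms \<open>A\<close>, \<open>A + t\<close>, \<open>B\<close>,
  \<open>B + t\<close> of \<open>k\<close>-sets\<close>

definition translate :: "int \<Rightarrow> int set \<Rightarrow> int set" where
  "translate t A = (\<lambda>x. x + t) ` A"

fun para :: "int set \<times> int set \<times> int \<Rightarrow> int set set" where
  "para (A, B, t) = {A, translate t A, B, translate t B}"

text \<open>
  The ranges are separated so that \<open>A\<close>, \<open>A + t\<close>, \<open>B\<close>, \<open>B + t\<close> are always pairwise distinct and contained
  in \<open>{1..4L}\<close>.
\<close>

definition para_index :: "nat \<Rightarrow> nat \<Rightarrow> (int set \<times> int set \<times> int) set" where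
  "para_index L k = nsets {1..int L} k \<times> nsets {2 * int L + 1..3 * int L} k \<times> {1..int L}"

lemma translate_translate [simp]: "translate s (translate t A) = translate (s + t) A"
  by (simp add: translate_def image_image ac_simps)

lemma translate_0 [simp]: "translate 0 A = A"
  by (simp add: translate_def)

lemma translate_sumset: "A + translate t B = translate t A + B"
proof -
  have "A + translate t B = (\<lambda>x. x + t) ` (A + B)"
    by (force simp: translate_def set_plus_def)
  moreover have "translate t A + B = (\<lambda>x. x + t) ` (A + B)"
    by (force simp: translate_def set_plus_def)
  ultimately show ?thesis by simp
qed

lemma Min_translate:
  assumes "finite A" "A \<noteq> {}"
  shows "Min (translate t A) = Min A + t"
  using Min_add_commute[OF assms, of id t] by (simp add: translate_def)

lemma para_indexD:
  assumes "(A, B, t) \<in> para_index L k" "k \<ge> 1"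
  shows "finite A" "A \<noteq> {}" "finite B" "B \<noteq> {}" "t \<ge> 1" "t \<le> int L"
    "A \<subseteq> {1..int L}" "B \<subseteq> {2 * int L + 1..3 * int L}" "card A = k" "card B = k"
  using assms by (auto simp: para_index_def nsets_def)

lemma finite_para_index [simp]: "finite (para_index L k)"
  by (simp add: para_index_def finite_imp_finite_nsets)

lemma card_para_index: "card (para_index L k) = (L choose k) * (L choose k) * L"
  by (simp add: para_index_def card_cartesian_product card_nsets_interval mult.assoc)

text \<open>The four minima differ: \<open>Min A + t\<close> is at most \<open>2 * L\<close>, below
  \<open>Min B\<close>, and \<open>t\<close> is positive.\<close>

lemma para_distinct:
  assumes "(A, B, t) \<in> para_index L k" "k \<ge> 1"
  shows "A \<noteq> translate t A" "B \<noteq> translate t B" "A \<noteq> B" "A \<noteq> translate t B"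
    "translate t A \<noteq> B" "translate t A \<noteq> translate t B"
proof -
  note D = para_indexD[OF assms]
  have "Min A \<in> {1..int L}" "Min B \<in> {2 * int L + 1..3 * int L}"
    using Min_in[OF D(1,2)] Min_in[OF D(3,4)] D(7,8) by blast+
  then obtain a b where "Min A = a" "Min B = b" "a \<le> int L" "2 * int L + 1 \<le> b"
    by auto
  then have "distinct [Min A, Min (translate t A), Min B, Min (translate t B)]"
    using D(5,6) Min_translate[OF D(1,2)] Min_translate[OF D(3,4)] by simp
  then show "A \<noteq> translate t A" "B \<noteq> translate t B" "A \<noteq> B" "A \<noteq> translate t B"
    "translate t A \<noteq> B" "translate t A \<noteq> translate t B"
    by auto
qed

lemma card_para:
  assumes "x \<in> para_index L k" "k \<ge> 1"
  shows "card (para x) = 4"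
proof -
  obtain A B t where x: "x = (A, B, t)" by (cases x)
  show ?thesis using para_distinct[of A B t L k] assms unfolding x by simp
qed

lemma finite_para [simp]: "finite (para x)"
  by (cases x) auto

lemma para_subset:
  assumes "x \<in> para_index L k" "k \<ge> 1" "4 * L \<le> N"
  shows "para x \<subseteq> k_subsets N k"
proof -
  obtain A B t where x: "x = (A, B, t)" by (cases x)
  note D = para_indexD[OF assms(1)[unfolded x] assms(2)]
  have "inj_on (\<lambda>y. y + t) S" for S by (simp add: inj_on_def)
  moreover have "translate t A \<subseteq> {1..int N}" "translate t B \<subseteq> {1..int N}"
    using D assms(3) by (fastforce simp: translate_def)+
  moreover have "A \<subseteq> {1..int N}" "B \<subseteq> {1..int N}"
    using D assms(3) by fastforce+
  ultimately show ?thesis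
    using D by (auto simp: x k_subsets_def nsets_def translate_def card_image)
qed

lemma para_not_sidon:
  assumes "x \<in> para_index L k" "k \<ge> 1" "para x \<subseteq> \<A>"
  shows "\<not> sidon_system \<A>"
proof
  assume sidon: "sidon_system \<A>"
  obtain A B t where x: "x = (A, B, t)" by (cases x)
  have "A \<in> \<A>" "translate t A \<in> \<A>" "B \<in> \<A>" "translate t B \<in> \<A>"
    using assms(3) by (simp_all add: x)
  then have "{A, translate t B} = {translate t A, B}"
    using translate_sumset[of A t B] by (intro sidon_systemD[OF sidon])
  then show False
    using para_distinct[of A B t L k] assms(1,2) unfolding x by (metis doubleton_eq_iff)
qed

section \<open>Parallelograms through given sets\<close>

lemma para_1:
  assumes "U \<in> para (A, B, t)"
  shows "A \<in> {U, translate (- t) U} \<or> B \<in> {U, translate (- t) U}"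
  using assms by auto

text \<open>Two sets of one translate pair reveal \<open>t\<close>; the absolute value covers both
  orders.\<close>

lemma same_pair:
  assumes "U \<in> {A, translate t A}" "V \<in> {A, translate t A}" "U \<noteq> V"
    and "finite A" "A \<noteq> {}" "t \<ge> 1"
  shows "t = \<bar>Min U - Min V\<bar>" "A \<in> {U, V}"
proof -
  have "U = A \<and> V = translate t A \<or> U = translate t A \<and> V = A"
    using assms(1-3) by (metis insertE singletonD)
  then show "t = \<bar>Min U - Min V\<bar>" "A \<in> {U, V}"
    using assms(4-6) by (elim disjE conjE; simp add: Min_translate)+
qed

text \<open>Given \<open>t\<close>, the set \<open>U\<close> pins down \<open>A\<close> or
  \<open>B\<close> in one of four ways; the other base set and \<open>t\<close> stay free.\<close>

lemma card_para_containing_1: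
  "card {x \<in> para_index L k. U \<in> para x} \<le> 4 * ((L choose k) * L)"
proof -
  define F where "F = nsets {1..int L} k"
  define G where "G = nsets {2 * int L + 1..3 * int L} k"
  define T where "T = {1..int L}"
  have fin: "finite F" "finite G" "finite T"
    by (auto simp: F_def G_def T_def finite_imp_finite_nsets)
  have card: "card (G \<times> T) = (L choose k) * L" "card (F \<times> T) = (L choose k) * L"
    by (simp_all add: F_def G_def T_def card_nsets_interval card_cartesian_product)
  let ?c1 = "\<lambda>(B, t). (U, B, t) :: int set \<times> int set \<times> int"
  let ?c2 = "\<lambda>(B, t). (translate (- t) U, B, t) :: int set \<times> int set \<times> int"
  let ?c3 = "\<lambda>(A, t). (A, U, t) :: int set \<times> int set \<times> int"
  let ?c4 = "\<lambda>(A, t). (A, translate (- t) U, t) :: int set \<times> int set \<times> int"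
  have "{x \<in> para_index L k. U \<in> para x} \<subseteq>
      ?c1 ` (G \<times> T) \<union> ?c2 ` (G \<times> T) \<union> ?c3 ` (F \<times> T) \<union> ?c4 ` (F \<times> T)"
  proof
    fix x assume x: "x \<in> {x \<in> para_index L k. U \<in> para x}"
    obtain A B t where x_eq: "x = (A, B, t)" by (cases x)
    have mem: "A \<in> F" "B \<in> G" "t \<in> T"
      using x by (auto simp: x_eq para_index_def F_def G_def T_def)
    have "A \<in> {U, translate (- t) U} \<or> B \<in> {U, translate (- t) U}"
      using x by (intro para_1) (auto simp: x_eq)
    then show "x \<in> ?c1 ` (G \<times> T) \<union> ?c2 ` (G \<times> T) \<union> ?c3 ` (F \<times> T) \<union> ?c4 ` (F \<times> T)"
      using mem by (auto simp: x_eq image_iff)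
  qed
  then have "card {x \<in> para_index L k. U \<in> para x} \<le>
      card (?c1 ` (G \<times> T) \<union> ?c2 ` (G \<times> T) \<union> ?c3 ` (F \<times> T) \<union> ?c4 ` (F \<times> T))"
    using fin by (intro card_mono) auto
  also have "\<dots> \<le> card (?c1 ` (G \<times> T)) + card (?c2 ` (G \<times> T)) + card (?c3 ` (F \<times> T)) + card (?c4 ` (F \<times> T))"
    by (meson add_le_mono1 card_Un_le order_trans)
  also have "\<dots> \<le> 4 * ((L choose k) * L)"
    using card_image_le[of "G \<times> T" ?c1] card_image_le[of "G \<times> T" ?c2]
      card_image_le[of "F \<times> T" ?c3] card_image_le[of "F \<times> T" ?c4] fin card by auto
  finally show ?thesis .
qed

text \<open>If \<open>U\<close> and \<open>V\<close> form one translate pair, then \<open>t\<close>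
  is fixed and only the other base set is free: twice \<open>2 * (L choose k)\<close>. If they lie
  in different pairs, \<open>t\<close> is free and \<open>A\<close>, \<open>B\<close> have two
  candidates each, in two orders: \<open>8 * L\<close>.\<close>

lemma card_para_containing_2:
  assumes "U \<noteq> V" "k \<ge> 1"
  shows "card {x \<in> para_index L k. {U, V} \<subseteq> para x} \<le> 4 * (L choose k) + 8 * L"
proof -
  define F where "F = nsets {1..int L} k"
  define G where "G = nsets {2 * int L + 1..3 * int L} k"
  define T where "T = {1..int L}"
  define \<tau> where "\<tau> = \<bar>Min U - Min V\<bar>"
  define pre where "pre Y t = {Y, translate (- t) Y}" for Y t
  define H where "H t = pre U t \<times> pre V t \<times> {t} \<union> pre V t \<times> pre U t \<times> {t}" for t
  have fin: "finite F" "finite G" "finite T" "finite (H t)" for t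
    by (auto simp: F_def G_def T_def H_def pre_def finite_imp_finite_nsets)
  have card: "card F = L choose k" "card G = L choose k" "card T = L"
    by (auto simp: F_def G_def T_def card_nsets_interval)
  let ?c1 = "{U, V} \<times> G \<times> {\<tau>}" and ?c2 = "F \<times> {U, V} \<times> {\<tau>}" and ?c3 = "\<Union>t\<in>T. H t"
  have "{x \<in> para_index L k. {U, V} \<subseteq> para x} \<subseteq> ?c1 \<union> ?c2 \<union> ?c3"
  proof
    fix x assume x: "x \<in> {x \<in> para_index L k. {U, V} \<subseteq> para x}"
    obtain A B t where x_eq: "x = (A, B, t)" by (cases x)
    have mem: "A \<in> F" "B \<in> G" "t \<in> T"
      using x by (auto simp: x_eq para_index_def F_def G_def T_def)
    have x': "(A, B, t) \<in> para_index L k" using x x_eq by simp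
    note D = para_indexD[OF x' assms(2)]
    define PA where "PA = {A, translate t A}"
    define PB where "PB = {B, translate t B}"
    have sub: "U \<in> PA \<or> U \<in> PB" "V \<in> PA \<or> V \<in> PB"
      using x by (auto simp: x_eq PA_def PB_def)
    have A: "A \<in> pre Y t" if "Y \<in> PA" for Y
      using that by (auto simp: pre_def PA_def)
    have B: "B \<in> pre Y t" if "Y \<in> PB" for Y
      using that by (auto simp: pre_def PB_def)
    from sub consider (AA) "U \<in> PA" "V \<in> PA" | (BB) "U \<in> PB" "V \<in> PB"
      | (AB) "U \<in> PA" "V \<in> PB" | (BA) "U \<in> PB" "V \<in> PA"
      by blast
    then show "x \<in> ?c1 \<union> ?c2 \<union> ?c3"
    proof cases
      case AA
      then have "t = \<tau>" "A \<in> {U, V}"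
        using same_pair[of U A t V] assms(1) D unfolding PA_def \<tau>_def by simp_all
      then have "x \<in> ?c1"
        using mem unfolding x_eq by (intro SigmaI singletonI) simp_all
      then show ?thesis by (intro UnI1)
    next
      case BB
      then have "t = \<tau>" "B \<in> {U, V}"
        using same_pair[of U B t V] assms(1) D unfolding PB_def \<tau>_def by simp_all
      then have "x \<in> ?c2"
        using mem unfolding x_eq by (intro SigmaI singletonI) simp_all
      then show ?thesis by (intro UnI1 UnI2)
    next
      case AB
      then have "x \<in> H t" unfolding x_eq H_def by (intro UnI1 SigmaI singletonI A B)
      then show ?thesis using mem by (intro UnI2 UN_I)
    next
      case BA
      then have "x \<in> H t" unfolding x_eq H_def by (intro UnI2 SigmaI singletonI A B)
      then show ?thesis using mem by (intro UnI2 UN_I)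
    qed
  qed
  then have "card {x \<in> para_index L k. {U, V} \<subseteq> para x} \<le> card (?c1 \<union> ?c2 \<union> ?c3)"
    using fin by (intro card_mono) auto
  also have "\<dots> \<le> card ?c1 + card ?c2 + card ?c3"
    by (meson add_le_mono1 card_Un_le order_trans)
  also have "\<dots> \<le> 2 * (L choose k) + 2 * (L choose k) + L * 8"
  proof (intro add_mono)
    have pre: "card (pre Y t) \<le> 2" for Y t by (simp add: pre_def card_insert_if)
    have prod: "card (pre Y t \<times> pre Z t \<times> {t}) \<le> 4" for Y Z t
      using mult_mono[OF pre[of Y t] pre[of Z t]] by (simp add: card_cartesian_product)
    have "card (H t) \<le> 8" for t
      unfolding H_def using card_Un_le prod[of U t V] prod[of V t U]
      by (smt (verit) add_mono le_trans numeral_Bit0)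
    then show "card ?c3 \<le> L * 8"
      using card_UN_le_mult[OF fin(3), of H 8] card by simp
  qed (use card assms in \<open>auto simp: card_cartesian_product\<close>)
  finally show ?thesis by simp
qed

text \<open>Two of the three sets share a translate pair, so \<open>t\<close> is one of three
  differences of minima. Neither pair holds all three, so both are met, and \<open>A\<close> and
  \<open>B\<close> each have at most 6 candidates: 3 * 36 = 108.\<close>

lemma card_para_containing_3:
  assumes "U \<noteq> V" "U \<noteq> W" "V \<noteq> W" "k \<ge> 1"
  shows "card {x \<in> para_index L k. {U, V, W} \<subseteq> para x} \<le> 108"
proof -
  define D where "D = {\<bar>Min U - Min V\<bar>, \<bar>Min U - Min W\<bar>, \<bar>Min V - Min W\<bar>}"
  define X where "X t = {U, V, W, translate (- t) U, translate (- t) V, translate (- t) W}" for t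
  have "{x \<in> para_index L k. {U, V, W} \<subseteq> para x} \<subseteq> (\<Union>t\<in>D. X t \<times> X t \<times> {t})"
  proof
    fix x assume x: "x \<in> {x \<in> para_index L k. {U, V, W} \<subseteq> para x}"
    obtain A B t where x_eq: "x = (A, B, t)" by (cases x)
    have x': "(A, B, t) \<in> para_index L k" using x x_eq by simp
    note d = para_indexD[OF x' assms(4)]
    define PA where "PA = {A, translate t A}"
    define PB where "PB = {B, translate t B}"
    have sub: "U \<in> PA \<or> U \<in> PB" "V \<in> PA \<or> V \<in> PB" "W \<in> PA \<or> W \<in> PB"
      using x by (auto simp: x_eq PA_def PB_def)
    have A: "t = \<bar>Min Y - Min Z\<bar>" if "Y \<in> PA" "Z \<in> PA" "Y \<noteq> Z" for Y Z
      using same_pair(1)[of Y A t Z] that d by (simp add: PA_def)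
    have B: "t = \<bar>Min Y - Min Z\<bar>" if "Y \<in> PB" "Z \<in> PB" "Y \<noteq> Z" for Y Z
      using same_pair(1)[of Y B t Z] that d by (simp add: PB_def)
    from sub consider "U \<in> PA" "V \<in> PA" | "U \<in> PB" "V \<in> PB" | "U \<in> PA" "W \<in> PA"
      | "U \<in> PB" "W \<in> PB" | "V \<in> PA" "W \<in> PA" | "V \<in> PB" "W \<in> PB"
      by blast
    then have "t \<in> D"
      by cases (use A B assms in \<open>simp_all add: D_def\<close>)
    have not3: "\<not> {U, V, W} \<subseteq> S" if "card S \<le> 2" "finite S" for S
    proof
      assume "{U, V, W} \<subseteq> S"
      then have "card {U, V, W} \<le> card S" using that by (intro card_mono)
      then show False using that assms by simp
    qed
    have "card PA \<le> 2" "finite PA" "card PB \<le> 2" "finite PB"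
      by (simp_all add: PA_def PB_def card_insert_if)
    then have "\<not> {U, V, W} \<subseteq> PA" "\<not> {U, V, W} \<subseteq> PB" using not3 by blast+
    then obtain Y Z where YZ: "Y \<in> {U, V, W}" "Y \<in> PA" "Z \<in> {U, V, W}" "Z \<in> PB"
      using sub by (metis insert_subset empty_subsetI insertCI)
    have "A = Y \<or> A = translate (- t) Y" "B = Z \<or> B = translate (- t) Z"
      using YZ(2,4) by (auto simp only: PA_def PB_def insert_iff empty_iff translate_translate
          add.left_inverse translate_0)
    then have "A \<in> X t" "B \<in> X t"
      using YZ(1,3) unfolding X_def by (elim insertE disjE emptyE; simp)+
    then show "x \<in> (\<Union>t\<in>D. X t \<times> X t \<times> {t})" using \<open>t \<in> D\<close> x_eq by blast
  qed
  then have "card {x \<in> para_index L k. {U, V, W} \<subseteq> para x} \<le> card (\<Union>t\<in>D. X t \<times> X t \<times> {t})"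
    by (rule card_mono[rotated]) (simp add: D_def X_def)
  also have "\<dots> \<le> card D * 36"
  proof (rule card_UN_le_mult)
    fix t
    have "card (X t) \<le> 6"
      using card_length[of "[U, V, W, translate (- t) U, translate (- t) V, translate (- t) W]"]
      by (simp add: X_def)
    then have "card (X t) * card (X t) \<le> 6 * 6" by (intro mult_mono) auto
    then show "card (X t \<times> X t \<times> {t}) \<le> 36" by (simp add: card_cartesian_product)
  qed (simp add: D_def)
  also have "\<dots> \<le> 3 * 36"
    using card_length[of "[\<bar>Min U - Min V\<bar>, \<bar>Min U - Min W\<bar>, \<bar>Min V - Min W\<bar>]"]
    by (simp add: D_def)
  finally show ?thesis by simp
qed

text \<open>For one, two and at least three given sets the counts have exponents
  \<open>k + 1\<close>, \<open>k\<close> and 0, within 3\<gamma>, 2\<gamma> and the remaining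
  nonnegative multiples. Four sets are handled through a three-element subset.\<close>

lemma card_para_containing:
  assumes k: "k \<ge> 1" and N: "N \<ge> 1" "L \<le> N" and R: "finite R" "R \<noteq> {}" "card R \<le> 4"
  shows "real (card {x \<in> para_index L k. R \<subseteq> para x}) \<le>
    108 * real N powr ((4 - real (card R)) * ((2 * real k + 1) / 4))"
proof -
  let ?d = "card {x \<in> para_index L k. R \<subseteq> para x}"
  have binom: "L choose k \<le> N ^ k"
  proof (cases "k \<le> L")
    case True
    then have "L choose k \<le> L ^ k" by (rule binomial_le_pow)
    also have "\<dots> \<le> N ^ k" using N by (simp add: power_mono)
    finally show ?thesis .
  qed (simp add: binomial_eq_0)
  have "card R \<noteq> 0" using R by simp
  then consider (one) "card R = 1" | (two) "card R = 2" | (more) "card R \<ge> 3" using R(3) by linarith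
  then have "\<exists>e. ?d \<le> 108 * N ^ e \<and> real e \<le> (4 - real (card R)) * ((2 * real k + 1) / 4)"
  proof cases
    case one
    then obtain U where "R = {U}" by (auto simp: card_1_singleton_iff)
    then have "?d \<le> 4 * ((L choose k) * L)" using card_para_containing_1[of L k U] by simp
    also have "\<dots> \<le> 4 * (N ^ k * N)" using binom N by (intro mult_mono) auto
    also have "\<dots> \<le> 108 * N ^ (k + 1)" by simp
    finally show ?thesis using one k by (intro exI[of _ "k + 1"]) auto
  next
    case two
    then obtain U V where "R = {U, V}" "U \<noteq> V" by (auto simp: card_2_iff)
    then have "?d \<le> 4 * (L choose k) + 8 * L" using card_para_containing_2[of U V k L] k by simp
    also have "\<dots> \<le> 4 * N ^ k + 8 * N ^ k"
      using binom N k by (intro add_mono mult_left_mono order.trans[OF N(2)] self_le_power) auto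
    finally show ?thesis using two by (intro exI[of _ k]) auto
  next
    case more
    then obtain S where "S \<subseteq> R" "card S = 3" by (meson obtain_subset_with_card_n)
    then obtain U V W where S: "S = {U, V, W}" "U \<noteq> V" "U \<noteq> W" "V \<noteq> W" by (auto simp: card_3_iff)
    have "?d \<le> card {x \<in> para_index L k. {U, V, W} \<subseteq> para x}"
      using \<open>S \<subseteq> R\<close> S by (intro card_mono) auto
    also have "\<dots> \<le> 108" using S k by (intro card_para_containing_3)
    finally show ?thesis using R(3) by (intro exI[of _ 0]) auto
  qed
  then obtain e where e: "?d \<le> 108 * N ^ e" "real e \<le> (4 - real (card R)) * ((2 * real k + 1) / 4)"
    by blast
  have "real ?d \<le> 108 * real (N ^ e)" using of_nat_mono[OF e(1), where ?'a = real] by simp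
  also have "\<dots> \<le> 108 * real N powr ((4 - real (card R)) * ((2 * real k + 1) / 4))"
    by (intro mult_left_mono power_le_powr N e) auto
  finally show ?thesis .
qed

text \<open>Each of the \<open>2 * k + 1\<close> factors in the lower bound for the count is at
  least \<open>N / (8 * k)\<close>, since \<open>N div 4\<close> is at least
  \<open>N / 8\<close>.\<close>

lemma card_para_index_ge:
  assumes "k \<ge> 1" "N \<ge> 8 * k"
  shows "real N powr (4 * ((2 * real k + 1) / 4)) / (8 * real k) ^ (2 * k + 1)
    \<le> real (card (para_index (N div 4) k))"
proof -
  let ?L = "N div 4"
  have "8 * ?L \<ge> N" "k \<le> ?L" using assms by linarith+
  then have L: "real N / (8 * real k) \<le> real ?L / real k" using assms by (simp add: field_simps)
  have binom: "(real N / (8 * real k)) ^ k \<le> real (?L choose k)"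
    using power_mono[OF L, of k] binomial_ge_n_over_k_pow_k[OF \<open>k \<le> ?L\<close>, where ?'a = real] by simp
  have "real ?L / real k \<le> real ?L"
    using assms mult_left_mono[of 1 "real k" "real ?L"] by (simp add: divide_le_eq)
  then have L': "real N / (8 * real k) \<le> real ?L" using L by linarith
  have "4 * ((2 * real k + 1) / 4) = real (2 * k + 1)" by simp
  then have "real N powr (4 * ((2 * real k + 1) / 4)) = real N powr real (2 * k + 1)"
    by (simp only:)
  also have "\<dots> = real N ^ (2 * k + 1)"
    using assms by (subst powr_realpow) auto
  finally have "real N powr (4 * ((2 * real k + 1) / 4)) / (8 * real k) ^ (2 * k + 1) =
      (real N / (8 * real k)) ^ (2 * k + 1)"
    by (simp only: power_divide)
  also have "\<dots> = (real N / (8 * real k)) ^ k * (real N / (8 * real k)) ^ k * (real N / (8 * real k))"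
    by (simp add: mult_2 power_add)
  also have "\<dots> \<le> real (?L choose k) * real (?L choose k) * real ?L"
    by (intro mult_mono binom L') auto
  also have "\<dots> = real (card (para_index ?L k))"
    by (simp add: card_para_index)
  finally show ?thesis .
qed

text \<open>The second moment bound with \<open>m = 4\<close>, where 15 = 2^4 - 1 counts the
  nonempty overlaps. The number 108 comes from the degree bounds and the power of
  \<open>8 * k\<close> from the number of parallelograms.\<close>

lemma prob_sidon_le:
  assumes k: "k \<ge> 1" "N \<ge> 8 * k" and p: "0 < p" "p \<le> 1"
    and large: "real N powr (- ((2 * real k + 1) / 4)) \<le> p"
  shows "measure_pmf.prob (random_system N k p) {\<A>. sidon_system \<A>} \<le>
    15 * (108 * (8 * real k) ^ (2 * k + 1)) * (real N powr (- ((2 * real k + 1) / 4)) / p)"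
proof -
  define \<gamma> where "\<gamma> = (2 * real k + 1) / 4"
  define C where "C = (8 * real k) ^ (2 * k + 1)"
  define u where "u = real N powr (- \<gamma>) / p"
  define L where "L = N div 4"
  have N: "N \<ge> 1" "L \<le> N" "4 * L \<le> N" using k by (auto simp: L_def)
  have C: "C > 0" using k by (simp add: C_def)
  have u: "0 < u" "u \<le> 1" using p large N by (auto simp: u_def \<gamma>_def)
  have cardP: "real N powr (4 * \<gamma>) \<le> C * real (card (para_index L k))"
    using card_para_index_ge[OF k] C unfolding \<gamma>_def C_def L_def by (simp add: divide_le_eq mult.commute)
  have "real N powr (4 * \<gamma>) > 0" using N by simp
  then have ne: "para_index L k \<noteq> {}" using cardP by (intro notI) simp
  have "measure_pmf.prob (random_system N k p) {\<A>. sidon_system \<A>} \<le>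
      measure_pmf.prob (random_system N k p) {\<A>. \<forall>x\<in>para_index L k. \<not> para x \<subseteq> \<A>}"
    using para_not_sidon[OF _ k(1)] by (intro measure_pmf.finite_measure_mono) auto
  also have "\<dots> \<le> (2 ^ 4 - 1) * (108 * C * u)"
  proof (rule second_moment_bound[OF finite_para_index ne p(1)])
    show "para x \<subseteq> k_subsets N k" if "x \<in> para_index L k" for x
      using para_subset[OF that k(1) N(3)] .
    show "card (para x) = 4" if "x \<in> para_index L k" for x
      using card_para[OF that k(1)] .
    show "measure_pmf.prob (random_system N k p) {\<A>. S \<subseteq> \<A>} = p ^ card S"
      if "S \<subseteq> k_subsets N k" for S
      using prob_random_system_superset[OF that] p by simp
    fix R :: "int set set"
    assume R: "R \<noteq> {}" "finite R" "card R \<le> 4"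
    have "real (card {x \<in> para_index L k. R \<subseteq> para x}) \<le> 108 * real N powr ((4 - real (card R)) * \<gamma>)"
      unfolding \<gamma>_def using card_para_containing[OF k(1) N(1,2) R(2,1,3)] .
    also have "real N powr ((4 - real (card R)) * \<gamma>) = real N powr (4 * \<gamma>) * real N powr (- (real (card R) * \<gamma>))"
      by (simp add: powr_add[symmetric] algebra_simps)
    also have "real N powr (- (real (card R) * \<gamma>)) = (real N powr (- \<gamma>)) ^ card R"
      using N by (simp add: powr_power)
    also have "\<dots> = u ^ card R * p ^ card R"
      using p by (simp add: u_def power_divide)
    also have "108 * (real N powr (4 * \<gamma>) * \<dots>) \<le> 108 * ((C * real (card (para_index L k))) * (u * p ^ card R))"
    proof (intro mult_left_mono mult_mono cardP mult_right_mono)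
      \<comment> \<open>One factor \<open>u\<close> is kept as the final decay rate; the others are
        at most 1.\<close>
      show "u ^ card R \<le> u"
        using u R power_decreasing[of 1 "card R" u] by (simp add: Suc_le_eq card_gt_0_iff)
    qed (use p u C in auto)
    also have "\<dots> = 108 * C * u * real (card (para_index L k)) * p ^ card R"
      by (simp only: mult_ac)
    finally show "real (card {x \<in> para_index L k. R \<subseteq> para x}) \<le>
        108 * C * u * real (card (para_index L k)) * p ^ card R" .
  qed simp
  finally show ?thesis by (simp add: C_def u_def \<gamma>_def)
qed

lemma prob_sidon_tendsto_0:
  fixes p :: "nat \<Rightarrow> real"
  assumes "k \<ge> 1" and p: "\<And>N. N > k \<Longrightarrow> 0 < p N \<and> p N \<le> 1"
    and large: "p \<in> \<omega>(\<lambda>N. real N powr (- (2 * real k + 1) / 4))"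
  shows "(\<lambda>N. measure_pmf.prob (random_system N k (p N)) {\<A>. sidon_system \<A>}) \<longlonglongrightarrow> 0"
proof -
  define \<gamma> where "\<gamma> = (2 * real k + 1) / 4"
  define u where "u N = real N powr (- \<gamma>) / p N" for N
  define c where "c = 15 * (108 * (8 * real k) ^ (2 * k + 1))"
  have "- (2 * real k + 1) / 4 = - \<gamma>" unfolding \<gamma>_def by linarith
  then have "(\<lambda>N. real N powr (- \<gamma>)) \<in> o(p)"
    using large by (simp only: smallomega_iff_smallo)
  then have u0: "u \<longlonglongrightarrow> 0"
    unfolding u_def by (rule smalloD_tendsto)
  have lim: "(\<lambda>N. c * u N) \<longlonglongrightarrow> 0"
    by (auto intro!: tendsto_eq_intros u0)
  show ?thesis
  proof (rule tendsto_sandwich[OF _ _ tendsto_const lim])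
    \<comment> \<open>This places \<open>p N\<close> above the threshold value, as
      \<open>prob_sidon_le\<close> demands.\<close>
    have "\<forall>\<^sub>F N in sequentially. u N < 1"
      using u0 by (rule order_tendstoD) simp
    then show "\<forall>\<^sub>F N in sequentially.
        measure_pmf.prob (random_system N k (p N)) {\<A>. sidon_system \<A>} \<le> c * u N"
      using eventually_ge_at_top[of "8 * k"]
    proof eventually_elim
      case (elim N)
      have N: "N > k" using elim(2) assms(1) by linarith
      have pN: "0 < p N" "p N \<le> 1" using p[OF N] by auto
      have "real N powr (- ((2 * real k + 1) / 4)) \<le> p N"
        using elim(1) pN by (simp add: u_def \<gamma>_def divide_less_eq)
      then show ?case
        unfolding c_def u_def \<gamma>_def by (rule prob_sidon_le[OF assms(1) elim(2) pN])
    qed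
  qed simp
qed

theorem theorem1p6:
  fixes k :: nat and p :: "nat \<Rightarrow> real"
  assumes "k \<ge> 2"
    and "\<And>N. N > k \<Longrightarrow> 0 < p N \<and> p N \<le> 1"
  shows "(p \<in> o(\<lambda>N. real N powr (- (2 * real k + 1) / 4)) \<longrightarrow>
            (\<lambda>N. measure_pmf.prob (random_system N k (p N)) {\<A>. sidon_system \<A>})
              \<longlonglongrightarrow> 1) \<and>
         (p \<in> \<omega>(\<lambda>N. real N powr (- (2 * real k + 1) / 4)) \<longrightarrow>
            (\<lambda>N. measure_pmf.prob (random_system N k (p N)) {\<A>. sidon_system \<A>})
              \<longlonglongrightarrow> 0)"
  using prob_sidon_tendsto_1[of k p] prob_sidon_tendsto_0[of k p] assms by auto

end
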